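(* Let $G$ be a finite group acting by simplicial automorphisms on a systolic complex $\mathbf X$ (not necessarily locally finite). Then there exists a (nonempty) simplex $\sigma\in\mathbf X$ which is invariant under the action of $G$, i.e. $g\sigma=\sigma$ for all $g\in G$.
   Context: All graphs are nonempty, undirected, connected, without loops or multiple edges. A simplicial complex is flag if every set of vertices, each pair of which lies in a common simplex, is contained in a simplex. A graph is bridged if it contains no isometric cycle of length greater than $3$ (an isometric subgraph is an induced subgraph in which distances coincide with those of the whole graph). A systolic complex is a flag simplicial complex whose $1$-skeleton is a (connected) bridged graph; equivalently, a simply connected simplicial complex in which the links of vertices are flag complexes without induced $4$- and $5$-cycles. *)

theory Defs
  imports "HOL-Algebra.Group_Action"
begin

text \<open>A graph is a vertex set together with an irreflexive symmetric adjacency relation; it may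
  be infinite and need not be locally finite.\<close>

definition simple_graph :: "'a set \<Rightarrow> ('a \<times> 'a) set \<Rightarrow> bool" where
  "simple_graph V E \<longleftrightarrow> V \<noteq> {} \<and> E \<subseteq> V \<times> V \<and> sym E \<and> irrefl E"

definition connected_graph :: "'a set \<Rightarrow> ('a \<times> 'a) set \<Rightarrow> bool" where
  "connected_graph V E \<longleftrightarrow> simple_graph V E \<and> (\<forall>u\<in>V. \<forall>v\<in>V. (u, v) \<in> E\<^sup>*)"

text \<open>The length of a shortest path; meaningful only when \<open>v\<close> is reachable from \<open>u\<close>.\<close>

definition graph_dist :: "('a \<times> 'a) set \<Rightarrow> 'a \<Rightarrow> 'a \<Rightarrow> nat" where
  "graph_dist E u v = (LEAST n. (u, v) \<in> E ^^ n)"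

definition induced_edges :: "('a \<times> 'a) set \<Rightarrow> 'a set \<Rightarrow> ('a \<times> 'a) set" where
  "induced_edges E W = E \<inter> W \<times> W"

text \<open>Connectedness of the induced subgraph is required explicitly, so that every distance
  compared below is the length of an actual path.\<close>

definition isometric_subgraph :: "'a set \<Rightarrow> ('a \<times> 'a) set \<Rightarrow> 'a set \<Rightarrow> bool" where
  "isometric_subgraph V E W \<longleftrightarrow> W \<subseteq> V \<and> connected_graph W (induced_edges E W) \<and>
     (\<forall>u\<in>W. \<forall>v\<in>W. graph_dist (induced_edges E W) u v = graph_dist E u v)"

definition cycle_graph :: "nat \<Rightarrow> 'a set \<Rightarrow> ('a \<times> 'a) set \<Rightarrow> bool" where
  "cycle_graph n W F \<longleftrightarrow> n \<ge> 3 \<and>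
     (\<exists>c. bij_betw c {..<n} W \<and>
        F = (\<Union>i<n. {(c i, c (Suc i mod n)), (c (Suc i mod n), c i)}))"

definition bridged_graph :: "'a set \<Rightarrow> ('a \<times> 'a) set \<Rightarrow> bool" where
  "bridged_graph V E \<longleftrightarrow> connected_graph V E \<and>
     \<not> (\<exists>W n. n > 3 \<and> cycle_graph n W (induced_edges E W) \<and> isometric_subgraph V E W)"

text \<open>An abstract simplicial complex is the set of its simplices, which are finite and nonempty;
  every vertex is itself a simplex.\<close>

definition simplicial_complex :: "'a set set \<Rightarrow> bool" where
  "simplicial_complex X \<longleftrightarrow>
     (\<forall>\<sigma>\<in>X. finite \<sigma> \<and> \<sigma> \<noteq> {}) \<and> (\<forall>\<sigma>\<in>X. \<forall>\<tau>\<subseteq>\<sigma>. \<tau> \<noteq> {} \<longrightarrow> \<tau> \<in> X)"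

definition vertices :: "'a set set \<Rightarrow> 'a set" where
  "vertices X = \<Union>X"

definition skeleton_edges :: "'a set set \<Rightarrow> ('a \<times> 'a) set" where
  "skeleton_edges X = {(u, v). u \<noteq> v \<and> {u, v} \<in> X}"

text \<open>The set \<open>A\<close> is not assumed to be finite. As simplices are finite, a flag complex therefore
  has no infinite clique in its 1-skeleton; vertices of infinite degree and simplices of unbounded
  dimension remain possible.\<close>

definition flag_complex :: "'a set set \<Rightarrow> bool" where
  "flag_complex X \<longleftrightarrow> simplicial_complex X \<and>
     (\<forall>A\<subseteq>vertices X. (\<forall>u\<in>A. \<forall>v\<in>A. \<exists>\<sigma>\<in>X. u \<in> \<sigma> \<and> v \<in> \<sigma>) \<longrightarrow> (\<exists>\<sigma>\<in>X. A \<subseteq> \<sigma>))"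

definition systolic_complex :: "'a set set \<Rightarrow> bool" where
  "systolic_complex X \<longleftrightarrow>
     flag_complex X \<and> bridged_graph (vertices X) (skeleton_edges X)"

definition simplicial_automorphism :: "'a set set \<Rightarrow> ('a \<Rightarrow> 'a) \<Rightarrow> bool" where
  "simplicial_automorphism X f \<longleftrightarrow> bij_betw f (vertices X) (vertices X) \<and>
     (\<forall>\<sigma>\<subseteq>vertices X. f ` \<sigma> \<in> X \<longleftrightarrow> \<sigma> \<in> X)"

end

theory Submission
  imports Defs
begin

text \<open>In a bridged graph the neighbours of a vertex \<open>z\<close> that are closer to a given vertex form a
  clique, and two adjacent vertices at the same distance from a given vertex have a common
  neighbour closer to it; both follow by turning a minimal counterexample around into an isometric
  cycle. Call a vertex set isometric if distances are realised inside it. These two conditions give: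
  the isometric sets are stable under taking unit neighbourhoods, and the vertices at maximal
  distance at least 2 from a vertex include one that is strictly dominated, i.e. whose closed
  neighbourhood is properly contained in another one.

  A descending chain of nonempty bounded isometric sets with empty intersection would produce such
  a chain inside the link of a vertex, inside the link of an edge, and so on, hence an infinite
  clique. So Zorn's lemma yields a minimal nonempty \<open>G\<close>-invariant isometric subset of an
  intersection of balls around an orbit. Deleting its strictly dominated vertices leaves a nonempty
  invariant isometric set; hence by minimality there are none, and the set is a clique.\<close>

section \<open>Distances in a connected graph\<close>

locale cgraph =
  fixes V :: "'a set" and E :: "('a \<times> 'a) set"
  assumes connected: "connected_graph V E"
begin

abbreviation adj :: "'a \<Rightarrow> 'a \<Rightarrow> bool" where "adj x y \<equiv> (x, y) \<in> E"
abbreviation d :: "'a \<Rightarrow> 'a \<Rightarrow> nat" where "d \<equiv> graph_dist E"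

lemma adj_sym: "adj x y \<Longrightarrow> adj y x"
  using connected by (auto simp: connected_graph_def simple_graph_def sym_def)

lemma adj_irrefl: "\<not> adj x x"
  using connected by (auto simp: connected_graph_def simple_graph_def irrefl_def)

lemma adj_V: assumes "adj x y" shows "x \<in> V" "y \<in> V"
  using connected assms by (auto simp: connected_graph_def simple_graph_def)

lemma V_nonempty: "V \<noteq> {}"
  using connected by (auto simp: connected_graph_def simple_graph_def)

lemma relpow_E_sym: "(u, v) \<in> E ^^ n \<Longrightarrow> (v, u) \<in> E ^^ n"
proof (induction n arbitrary: v)
  case (Suc n)
  then obtain w where "(u, w) \<in> E ^^ n" "adj w v" by auto
  then show ?case using Suc.IH adj_sym by (meson relpow_Suc_I2)
qed auto

lemma d_path:
  assumes "u \<in> V" "v \<in> V"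
  shows "(u, v) \<in> E ^^ d u v"
proof -
  have "(u, v) \<in> E\<^sup>*" using connected assms by (auto simp: connected_graph_def)
  then obtain n where "(u, v) \<in> E ^^ n" using rtrancl_imp_relpow by blast
  then show ?thesis unfolding graph_dist_def by (rule LeastI)
qed

lemma d_le: "(u, v) \<in> E ^^ n \<Longrightarrow> d u v \<le> n"
  unfolding graph_dist_def by (rule Least_le)

lemma d_sym: "d u v = d v u"
proof -
  have "(u, v) \<in> E ^^ n \<longleftrightarrow> (v, u) \<in> E ^^ n" for n using relpow_E_sym by blast
  then show ?thesis unfolding graph_dist_def by simp
qed

lemma d_refl [simp]: "d u u = 0"
  using d_le[of u u 0] by simp

lemma d_triangle:
  assumes "u \<in> V" "v \<in> V" "w \<in> V"
  shows "d u w \<le> d u v + d v w"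
  by (rule d_le) (use assms d_path in \<open>auto simp: relpow_add\<close>)

lemma d_eq_0 [simp]:
  assumes "u \<in> V" "v \<in> V"
  shows "d u v = 0 \<longleftrightarrow> u = v"
  using d_path[OF assms] by auto

lemma d_adj: assumes "adj u v" shows "d u v = 1"
proof -
  have "d u v \<noteq> 0" using assms adj_V[OF assms] adj_irrefl by auto
  then show ?thesis using d_le[of u v 1] assms by auto
qed

lemma d_eq_1:
  assumes "u \<in> V" "v \<in> V"
  shows "d u v = 1 \<longleftrightarrow> adj u v"
  using d_adj d_path[OF assms] by auto

lemma d_step:
  assumes "u \<in> V" "v \<in> V" "u \<noteq> v"
  obtains z where "adj u z" "Suc (d v z) = d v u"
proof -
  obtain n where n: "d u v = Suc n" using assms d_eq_0 by (metis not0_implies_Suc)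
  then obtain z where z: "adj u z" "(z, v) \<in> E ^^ n"
    using d_path[OF assms(1,2)] by (metis relpow_Suc_D2)
  have "d z v \<le> n" using z by (simp add: d_le)
  moreover have "d u v \<le> d u z + d z v" using assms z adj_V by (intro d_triangle) auto
  ultimately have "Suc (d v z) = d v u" using n d_adj[OF z(1)] by (simp add: d_sym)
  then show ?thesis using that z by blast
qed

lemma d_adj_le:
  assumes "adj a b" "v \<in> V"
  shows "d v a \<le> Suc (d v b)" "d v b \<le> Suc (d v a)"
  using d_triangle[of v b a] d_triangle[of v a b] assms adj_V[OF assms(1)] d_adj[OF assms(1)]
  by (auto simp: d_sym)

lemma d_two:
  assumes "adj a b" "adj b c" "a \<noteq> c" "\<not> adj a c"
  shows "d a c = 2"
proof -
  have V: "a \<in> V" "c \<in> V" using assms adj_V by blast+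
  have "d a c \<le> 2" using d_adj_le[OF assms(2) V(1)] d_adj[OF assms(1)] by auto
  moreover have "d a c \<noteq> 0" "d a c \<noteq> 1" using V assms d_eq_1[OF V] by auto
  ultimately show ?thesis by linarith
qed

subsection \<open>Isometric cycles\<close>

lemma walk_relpow:
  assumes "\<And>i. (c i, c (Suc i)) \<in> F"
  shows "(c i, c (i + r)) \<in> F ^^ r"
  using assms by (induction r) auto

text \<open>A stretch of at most \<open>k\<close> steps is part of an antipodal geodesic, hence
  geodesic, and two vertices of the walk are at most \<open>k\<close> steps apart one way round. So
  walk distance is graph distance: the vertices are distinct, there are no chords, and the cycle is
  isometric.\<close>

lemma isometric_cycle:
  assumes adj: "\<And>i. adj (c i) (c (Suc i))"
    and per: "\<And>i. c (i + L) = c i"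
    and anti: "\<And>i. d (c i) (c (i + k)) = k"
    and L: "L = 2 * k \<or> L = 2 * k + 1" "L > 3"
  shows "\<exists>W. cycle_graph L W (induced_edges E W) \<and> isometric_subgraph V E W"
proof -
  define W where "W = c ` {..<L}"
  define F where "F = induced_edges E W"
  have per_mult: "c (i + q * L) = c i" for i q
    by (induction q) (auto simp: per add.assoc[symmetric] intro: per[THEN trans], metis add.assoc add.commute per)
  have cmod: "c (i mod L) = c i" for i
    using per_mult[of "i mod L" "i div L"] by simp
  have cW: "c i \<in> W" for i
    unfolding W_def using cmod[of i] L by (metis image_eqI lessThan_iff mod_less_divisor not_numeral_le_zero not_less less_trans zero_less_numeral)
  have cV: "c i \<in> V" for i using adj adj_V by blast
  have F_adj: "(c i, c (Suc i)) \<in> F" for i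
    unfolding F_def induced_edges_def using adj cW by auto
  have geod: "d (c i) (c (i + r)) = r" if "r \<le> k" for i r
  proof -
    have 1: "d (c i) (c (i + r)) \<le> r" using d_le walk_relpow[of c E, OF adj] by blast
    have 2: "d (c (i + r)) (c (i + r + (k - r))) \<le> k - r"
      using d_le walk_relpow[of c E, OF adj] by blast
    have "k \<le> d (c i) (c (i + r)) + d (c (i + r)) (c (i + k))"
      using d_triangle[of "c i" "c (i + r)" "c (i + k)"] anti cV by metis
    then show ?thesis using 1 2 that by simp
  qed
  have pair: "\<exists>i r. r \<le> k \<and> ((u = c i \<and> v = c (i + r)) \<or> (v = c i \<and> u = c (i + r)))"
    if uv: "u \<in> W" "v \<in> W" for u v
  proof -
    have *: "\<exists>i r. r \<le> k \<and> ((c a = c i \<and> c b = c (i + r)) \<or> (c b = c i \<and> c a = c (i + r)))"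
      if "a \<le> b" "b < L" for a b
    proof (cases "b - a \<le> k")
      case True
      then show ?thesis using that by (intro exI[of _ a] exI[of _ "b - a"]) auto
    next
      case False
      \<comment> \<open>The other way round, from \<open>b\<close> through the end of the period to
        \<open>a\<close>, takes \<open>L - (b - a)\<close> steps, at most \<open>k\<close> because
        \<open>L \<le> 2 * k + 1\<close>.\<close>
      have "b + (L + a - b) = a + L" using that by simp
      then have "c a = c (b + (L + a - b))" using per[of a] by simp
      moreover have "L + a - b \<le> k" using False L(1) by auto
      ultimately show ?thesis by blast
    qed
    obtain a b where ab: "u = c a" "v = c b" "a < L" "b < L" using uv unfolding W_def by auto
    show ?thesis
    proof (cases "a \<le> b")
      case True
      then show ?thesis using *[of a b] ab by simp
    next
      case False
      then have "b \<le> a" by simp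
      then show ?thesis using *[of b a] ab by blast
    qed
  qed
  have F_sym: "sym F"
    unfolding F_def induced_edges_def sym_def using adj_sym by auto
  have F_path: "(c i, c (i + r)) \<in> F ^^ r" for i r using walk_relpow[of c F, OF F_adj] .
  have F_path': "(c (i + r), c i) \<in> F ^^ r" for i r
  proof (induction r)
    case (Suc r)
    have "(c (i + Suc r), c (i + r)) \<in> F" using F_adj[of "i + r"] F_sym by (simp add: sym_def)
    then show ?case using Suc by (meson relpow_Suc_I2)
  qed simp
  have F_sub: "F ^^ n \<subseteq> E ^^ n" for n
    by (induction n) (auto simp: F_def induced_edges_def)
  have gdF: "graph_dist F u v = d u v" if "(u, v) \<in> F ^^ d u v" for u v
    unfolding graph_dist_def[of F]
  proof (rule Least_equality)
    show "(u, v) \<in> F ^^ d u v" by fact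
    show "d u v \<le> n" if "(u, v) \<in> F ^^ n" for n using that F_sub d_le by blast
  qed
  have Fd: "(u, v) \<in> F ^^ d u v" if uv: "u \<in> W" "v \<in> W" for u v
  proof -
    obtain i r where "r \<le> k" "(u = c i \<and> v = c (i + r)) \<or> (v = c i \<and> u = c (i + r))"
      using pair[OF uv] by blast
    then show ?thesis using geod F_path F_path' d_sym by metis
  qed
  have iso: "isometric_subgraph V E W"
    unfolding isometric_subgraph_def connected_graph_def simple_graph_def F_def[symmetric]
  proof (intro conjI ballI)
    show "W \<subseteq> V" using cV W_def by auto
    show "W \<noteq> {}" using cW by blast
    show "F \<subseteq> W \<times> W" by (auto simp: F_def induced_edges_def)
    show "irrefl F" using adj_irrefl by (auto simp: F_def induced_edges_def irrefl_def)
    show "(u, v) \<in> F\<^sup>*" if "u \<in> W" "v \<in> W" for u v using Fd[OF that] relpow_imp_rtrancl by blast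
    show "graph_dist F u v = d u v" if "u \<in> W" "v \<in> W" for u v using gdF[OF Fd[OF that]] .
  qed (rule F_sym)
  have inj: "inj_on c {..<L}"
  proof (rule linorder_inj_onI)
    fix a b :: nat assume ab: "a < b" "b \<in> {..<L}"
    show "c a \<noteq> c b"
    proof (cases "b - a \<le> k")
      case True
      then show ?thesis using geod[of "b - a" a] ab by (metis d_refl le_add_diff_inverse less_imp_le not_less zero_less_diff bot_nat_0.extremum)
    next
      case False
      have "L + a - b \<le> k" using False L(1) by auto
      moreover have "b + (L + a - b) = a + L" using ab by simp
      ultimately have "d (c b) (c a) = L + a - b" using geod[of "L + a - b" b] per[of a] by simp
      then have "d (c b) (c a) \<noteq> 0" using ab by simp
      then show ?thesis by (metis d_refl)
    qed
  qed auto
  have edges: "F = (\<Union>i<L. {(c i, c (Suc i mod L)), (c (Suc i mod L), c i)})" (is "_ = ?R")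
  proof
    show "?R \<subseteq> F"
      using F_adj F_sym by (auto simp: cmod sym_def)
    show "F \<subseteq> ?R"
    proof (clarify)
      fix u v assume uv: "(u, v) \<in> F"
      then have "adj u v" "u \<in> W" "v \<in> W" by (auto simp: F_def induced_edges_def)
      then have *: "d u v = 1" "d v u = 1" using d_adj d_sym by metis+
      obtain i r where ir: "r \<le> k" "(u = c i \<and> v = c (i + r)) \<or> (v = c i \<and> u = c (i + r))"
        using pair \<open>u \<in> W\<close> \<open>v \<in> W\<close> by blast
      then have "r = 1" using geod * by metis
      then have "(u = c (i mod L) \<and> v = c (Suc (i mod L) mod L)) \<or> (v = c (i mod L) \<and> u = c (Suc (i mod L) mod L))"
        using ir by (simp add: cmod mod_Suc_eq)
      moreover have "i mod L < L" using L by simp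
      ultimately show "(u, v) \<in> ?R" by blast
    qed
  qed
  have "cycle_graph L W (induced_edges E W)"
    unfolding cycle_graph_def F_def[symmetric]
    using L inj edges by (intro conjI exI[of _ c]) (auto simp: bij_betw_def W_def)
  then show ?thesis using iso by blast
qed

subsection \<open>Interval and triangle conditions\<close>

text \<open>Indexed by the distance because this condition and \<open>triangle_cond\<close> are
  proved together by strong induction on it.\<close>

definition interval_cond :: "nat \<Rightarrow> bool" where
  "interval_cond n \<longleftrightarrow> (\<forall>v\<in>V. \<forall>x y z. adj z x \<longrightarrow> adj z y \<longrightarrow> d v z = n \<longrightarrow>
     Suc (d v x) = n \<longrightarrow> Suc (d v y) = n \<longrightarrow> x = y \<or> adj x y)"

text \<open>This is the triangle condition of weakly modular graphs.\<close>

definition triangle_cond :: "nat \<Rightarrow> bool" where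
  "triangle_cond n \<longleftrightarrow> (\<forall>v\<in>V. \<forall>x y. adj x y \<longrightarrow> d v x = n \<longrightarrow> d v y = n \<longrightarrow>
     (\<exists>z. adj x z \<and> adj y z \<and> Suc (d v z) = n))"

definition C5_free :: bool where
  "C5_free \<longleftrightarrow> (\<forall>a b c e f. adj a b \<longrightarrow> adj b c \<longrightarrow> adj c e \<longrightarrow> adj e f \<longrightarrow> adj f a \<longrightarrow>
     a = c \<or> b = e \<or> c = f \<or> e = a \<or> f = b \<or>
     adj a c \<or> adj b e \<or> adj c f \<or> adj e a \<or> adj f b)"

lemma interval_condD:
  "interval_cond n \<Longrightarrow> v \<in> V \<Longrightarrow> adj z x \<Longrightarrow> adj z y \<Longrightarrow> d v z = n \<Longrightarrow> Suc (d v x) = n \<Longrightarrow>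
   Suc (d v y) = n \<Longrightarrow> x = y \<or> adj x y"
  unfolding interval_cond_def by blast

lemma triangle_condD:
  assumes "triangle_cond n" "v \<in> V" "adj x y" "d v x = n" "d v y = n"
  obtains z where "adj x z" "adj y z" "Suc (d v z) = n"
  using assms unfolding triangle_cond_def by blast

text \<open>The six vertices lie on a closed walk of length \<open>2m + 3\<close> that would be isometric. A neighbour
  \<open>w\<close> of \<open>a\<close> and \<open>x\<close> closer to \<open>b\<close> turns out to be adjacent to the second vertex after \<open>a\<close> on the
  geodesic through \<open>a1\<close> and \<open>c\<close>, which brings \<open>x\<close> too close to \<open>c\<close>; for \<open>m = 1\<close> the walk is an
  induced pentagon.\<close>

lemma key_configuration:
  assumes interval_cond: "interval_cond (Suc m)" and triangle_cond: "triangle_cond (Suc m)" and C5: "C5_free" and m: "m \<ge> 1"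
    and adj: "adj a x" "adj b y" "adj a a1" "adj b c"
    and dist: "d x y = m" "d a b = Suc m" "d a y = Suc m" "d x b = Suc m" "Suc (d a1 c) = m"
    and x: "x \<noteq> a1" "\<not> adj x a1" and y: "y \<noteq> c" "\<not> adj y c"
  shows False
proof -
  have V: "a \<in> V" "x \<in> V" "b \<in> V" "y \<in> V" "a1 \<in> V" "c \<in> V" using adj adj_V by blast+
  have a1b: "d a1 b = m" using d_adj_le[OF adj(4) V(5)] d_adj_le[OF adj(3) V(3)] dist by (simp add: d_sym)
  have ac: "d a c = m" using d_adj_le[OF adj(4) V(1)] d_adj_le[OF adj(3) V(6)] dist by (simp add: d_sym)
  \<comment> \<open>Otherwise \<open>x\<close> and \<open>a1\<close> would both be closer to
    \<open>y\<close> than \<open>a\<close> is, hence equal or adjacent.\<close>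
  have a1y: "d a1 y = Suc m"
  proof -
    have "d y a1 \<noteq> m"
      using interval_condD[OF interval_cond V(4) adj(1) adj(3)] x dist by (auto simp: d_sym)
    then show ?thesis using d_adj_le[OF adj(3) V(4)] d_adj_le[OF adj(2) V(5)] dist a1b by (simp add: d_sym)
  qed
  have cx: "d x c = Suc m"
  proof -
    have "d x c \<noteq> m"
      using interval_condD[OF interval_cond V(2) adj(2) adj(4)] y dist by (auto simp: d_sym)
    then show ?thesis using d_adj_le[OF adj(4) V(2)] d_adj_le[OF adj(1) V(6)] dist ac by (simp add: d_sym)
  qed
  show False
  proof (cases "m = 1")
    case True
    then have "a1 = c" using dist V d_eq_0 by simp
    have "d a b = 2" "d a y = 2" "d x b = 2" "d a1 y = 2" using dist a1y True by auto
    then have "\<not> adj a b" "a \<noteq> b" "\<not> adj a y" "a \<noteq> y" "\<not> adj x b" "x \<noteq> b" "\<not> adj a1 y" "a1 \<noteq> y"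
      using d_adj by fastforce+
    moreover have "adj x y" using dist True d_eq_1[OF V(2) V(4)] by simp
    ultimately show False
      using C5[unfolded C5_free_def, rule_format, OF adj(3) _ adj(2) _ adj(1)[THEN adj_sym]]
        adj(4)[THEN adj_sym] x \<open>a1 = c\<close> adj_sym by blast
  next
    case False
    obtain w where w: "adj x w" "adj a w" "d b w = m"
      using triangle_condD[OF triangle_cond V(3) adj(1)[THEN adj_sym]] dist by (auto simp: d_sym)
    have wV: "w \<in> V" using w adj_V by blast
    have "w \<noteq> a1" using w x by auto
    then have wa1: "adj w a1" using interval_condD[OF interval_cond V(3) w(2) adj(3)] w(3) a1b dist by (auto simp: d_sym)
    \<comment> \<open>A step \<open>x1\<close> from \<open>x\<close> towards \<open>y\<close> also
      approaches \<open>b\<close>, so it equals \<open>w\<close> or is adjacent to it; this bounds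
      \<open>d w y\<close>.\<close>
    have "d w y = m"
    proof -
      have "x \<noteq> y" using dist m by auto
      then obtain x1 where x1: "adj x x1" "Suc (d y x1) = d y x" using d_step[OF V(2) V(4)] by blast
      have x1V: "x1 \<in> V" using x1 adj_V by blast
      have "d b x1 = m" using d_adj_le[OF x1(1) V(3)] d_adj_le[OF adj(2) x1V] x1(2) dist
        by (simp add: d_sym)
      then have "x1 = w \<or> adj x1 w" using interval_condD[OF interval_cond V(3) x1(1) w(1)] w(3) dist by (auto simp: d_sym)
      then have "d y w \<le> m" using x1(2) dist d_adj_le[of x1 w y] V by (auto simp: d_sym)
      moreover have "Suc m \<le> Suc (d y w)" using d_adj_le[OF w(2) V(4)] dist by (auto simp: d_sym)
      ultimately show ?thesis by (simp add: d_sym)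
    qed
    moreover have "a1 \<noteq> c" using False dist by (auto simp: d_sym)
    then obtain a2 where a2: "adj a1 a2" "Suc (d c a2) = d c a1" using d_step[OF V(5) V(6)] by blast
    have a2V: "a2 \<in> V" using a2 adj_V by blast
    have a2b: "Suc (d b a2) = m"
      using d_adj_le[OF a2(1) V(3)] d_adj_le[OF adj(4) a2V] a2(2) dist a1b by (simp add: d_sym)
    have "d y a2 = m"
      using d_adj_le[OF a2(1) V(4)] d_adj_le[OF adj(2) a2V] a2b a1y by (simp add: d_sym)
    ultimately have "w = a2 \<or> adj w a2"
      using interval_condD[OF interval_cond V(4) wa1[THEN adj_sym] a2(1)] a1y by (auto simp: d_sym)
    then have "adj w a2" using a2b w(3) by auto
    then have "d x a2 \<le> 2" using d_adj_le[of w a2 x] V d_adj[OF w(1)] by auto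
    moreover have "d x c \<le> d x a2 + d a2 c" using d_triangle V a2V by blast
    ultimately show False using cx a2(2) dist by (simp add: d_sym)
  qed
qed

text \<open>Otherwise \<open>y\<close> is not closer to \<open>b\<close> than \<open>x\<close> is,
  and a first step \<open>c\<close> from \<open>b\<close> towards \<open>u\<close> completes the
  configuration excluded by \<open>key_configuration\<close>. Used for the interval condition and
  again for finding a dominated vertex.\<close>

lemma parent_adj:
  assumes interval_cond: "interval_cond n" and triangle_cond: "triangle_cond n" and C5: "C5_free" and n: "n \<ge> 2"
    and adj: "adj p b" "adj x u" "adj x y"
    and dist: "d p x = n" "d p u = n" "d b x = n" "Suc (d b u) = n" "Suc (d p y) = n"
  shows "adj y u"
proof (rule ccontr)
  assume yu: "\<not> adj y u"
  have V: "p \<in> V" "b \<in> V" "x \<in> V" "u \<in> V" "y \<in> V" using adj adj_V by blast+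
  obtain m where m: "n = Suc m" "m \<ge> 1" using n by (cases n) auto
  have "y \<noteq> u" using dist by (auto simp: d_sym)
  then have "Suc (d b y) \<noteq> n" using interval_condD[OF interval_cond V(2) adj(3) adj(2)] dist yu by auto
  then have by_n: "d b y = n"
    using d_adj_le[OF adj(3) V(2)] d_adj_le[OF adj(1) V(5)] dist by (auto simp: d_sym)
  have "u \<noteq> b" using dist m by auto
  then obtain c where c: "adj b c" "Suc (d u c) = d u b" using d_step[OF V(2) V(4)] by blast
  have "p \<noteq> c" using c dist by (auto simp: d_sym)
  moreover have "\<not> adj p c"
    using c dist d_adj_le[of p c u] V by (auto simp: d_sym)
  ultimately show False
    using key_configuration[of m x y b p u c] m interval_cond triangle_cond C5 adj(2,3) adj(1)[THEN adj_sym] c dist yu by_n \<open>y \<noteq> u\<close>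
    by (auto simp: d_sym)
qed

text \<open>A counterexample to the interval condition with base \<open>v\<close> and apex \<open>z\<close> on a closed walk of
  length \<open>2k\<close> forces the next antipodal pair of the walk to be at distance \<open>k\<close> as well.\<close>

lemma interval_antipodal:
  assumes interval_cond: "\<And>j. j < k \<Longrightarrow> interval_cond j" and triangle_cond: "\<And>j. j < k \<Longrightarrow> triangle_cond j" and C5: "C5_free" and k: "k \<ge> 2"
    and adj: "adj z x" "adj z y" "adj v y1"
    and dist: "d v z = k" "Suc (d v x) = k" "Suc (d v y) = k" "Suc (Suc (d y1 y)) = k"
    and xy: "x \<noteq> y" "\<not> adj x y"
  shows "d x y1 = k"
proof (cases "k = 2")
  case True
  then have "d y1 y = 0" using dist by simp
  then have "y1 = y" using d_eq_0 adj_V[OF adj(3)] adj_V[OF adj(2)] by blast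
  then show ?thesis using d_two[OF adj(1)[THEN adj_sym] adj(2)] xy True by simp
next
  case False
  obtain n where n: "k = Suc n" "n \<ge> 2" using k False by (cases k) auto
  have V: "x \<in> V" "y \<in> V" "z \<in> V" "v \<in> V" "y1 \<in> V" using adj adj_V by blast+
  have intn: "interval_cond n" and trin: "triangle_cond n" using interval_cond triangle_cond n by auto
  have y1z: "d y1 z = n"
    using d_adj_le[OF adj(3) V(3)] d_adj_le[OF adj(2) V(5)] dist n by (simp add: d_sym)
  have le: "d x y1 \<le> k" "d x y1 \<ge> n - 1"
    using d_adj_le[OF adj(3) V(1)] d_adj_le[OF adj(1) V(5)] dist n y1z by (auto simp: d_sym)
  have ne: "Suc (d y1 x) \<noteq> n"
    using interval_condD[OF intn V(5) adj(1,2)] y1z dist n xy by auto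
  \<comment> \<open>At distance \<open>n\<close>, a common neighbour \<open>s\<close> of
    \<open>v\<close> and \<open>y1\<close> nearer to \<open>x\<close> would have both
    \<open>z\<close> and \<open>y\<close> at distance \<open>n\<close>, and
    \<open>parent_adj\<close> with the edge \<open>s y1\<close> would make \<open>x\<close> and
    \<open>y\<close> adjacent.\<close>
  have "d x y1 \<noteq> n"
  proof
    assume xy1: "d x y1 = n"
    obtain s where s: "adj v s" "adj y1 s" "Suc (d x s) = n"
      using triangle_condD[OF trin V(1) adj(3)] xy1 dist n by (auto simp: d_sym)
    have sV: "s \<in> V" using s adj_V by blast
    have sz: "d s z = n"
      using d_adj_le[OF s(1) V(3)] d_adj_le[OF adj(1) sV] dist n s(3) by (auto simp: d_sym)
    have "Suc (d s y) \<noteq> n"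
      using interval_condD[OF intn sV adj(1,2)] sz s(3) xy by (auto simp: d_sym)
    then have "d s y = n"
      using d_adj_le[OF s(2) V(2)] d_adj_le[OF adj(2) sV] dist n sz by (auto simp: d_sym)
    then have "adj x y"
      using parent_adj[OF intn trin C5 n(2) s(2)[THEN adj_sym] adj(2,1)] sz s(3) dist n y1z
      by (auto simp: d_sym)
    then show False using xy by blast
  qed
  then show ?thesis using le ne n by (auto simp: d_sym)
qed

text \<open>A counterexample to the triangle condition with base \<open>v\<close> and opposite edge \<open>xy\<close> yields one
  with base \<open>x\<close> and opposite edge \<open>v y1\<close>.\<close>

lemma triangle_antipodal:
  assumes interval_cond: "interval_cond k" and triangle_cond: "\<And>j. j < k \<Longrightarrow> triangle_cond j" and k: "k \<ge> 2"
    and adj: "adj x y" "adj v y1"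
    and dist: "d v x = k" "d v y = k" "Suc (d y1 y) = k"
    and no: "\<And>z. adj x z \<Longrightarrow> adj y z \<Longrightarrow> Suc (d v z) \<noteq> k"
  shows "d x y1 = k" and "\<And>s. adj v s \<Longrightarrow> adj y1 s \<Longrightarrow> Suc (d x s) \<noteq> k"
proof -
  obtain n where n: "k = Suc n" "n \<ge> 1" using k by (cases k) auto
  have V: "x \<in> V" "y \<in> V" "v \<in> V" "y1 \<in> V" using adj adj_V by blast+
  \<comment> \<open>Otherwise the triangle condition with base \<open>s\<close>, at the smaller
    distance \<open>n\<close>, gives a common neighbour of \<open>x\<close> and \<open>y\<close>
    closer to \<open>v\<close>.\<close>
  have no_common: "\<not> (d s x = n \<and> d s y = n)" if s: "adj v s" for s
  proof
    assume sxy: "d s x = n \<and> d s y = n"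
    have sV: "s \<in> V" using s adj_V by blast
    obtain z where z: "adj x z" "adj y z" "Suc (d s z) = n"
      using triangle_condD[OF triangle_cond[of n] sV adj(1)] sxy n by auto
    have "z \<in> V" using z adj_V by blast
    then have "Suc (d v z) = k"
      using d_adj_le[OF s, of z] d_adj_le[OF z(1) V(3)] dist n z(3) by (auto simp: d_sym)
    then show False using no z by blast
  qed
  have "d x y1 \<noteq> n" using no_common[OF adj(2)] dist n by (auto simp: d_sym)
  then show xy1: "d x y1 = k"
    using d_adj_le[OF adj(2) V(1)] d_adj_le[OF adj(1) V(4)] dist n by (auto simp: d_sym)
  show "Suc (d x s) \<noteq> k" if s: "adj v s" "adj y1 s" for s
  proof
    assume "Suc (d x s) = k"
    then have sx: "d s x = n" using n by (simp add: d_sym)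
    have sV: "s \<in> V" using s adj_V by blast
    have "d s y \<noteq> n" using no_common s sx by blast
    then have sy: "d s y = k"
      using d_adj_le[OF s(1) V(2)] d_adj_le[OF adj(1) sV] dist n sx by (auto simp: d_sym)
    \<comment> \<open>The first step \<open>q\<close> from \<open>y\<close> towards
      \<open>y1\<close> approaches \<open>s\<close> as well, so the interval condition makes it a
      neighbour of \<open>x\<close>; it is then a forbidden common neighbour of \<open>x\<close> and
      \<open>y\<close>.\<close>
    have "y \<noteq> y1" using dist n by auto
    then obtain q where q: "adj y q" "Suc (d y1 q) = d y1 y" using d_step[OF V(2) V(4)] by blast
    have qV: "q \<in> V" using q adj_V by blast
    have "d s q = n"
      using d_adj_le[OF s(2) qV] d_adj_le[OF q(1) sV] q(2) sy dist n by (auto simp: d_sym)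
    then have "x = q \<or> adj x q"
      using interval_condD[OF interval_cond sV adj(1)[THEN adj_sym] q(1)] sy sx n by auto
    moreover have "x \<noteq> q" using q(2) xy1 dist n by (auto simp: d_sym)
    ultimately have "adj x q" by blast
    moreover have "Suc (d v q) = k"
      using d_adj_le[OF adj(2) qV] d_adj_le[OF q(1) V(3)] q(2) dist n by (auto simp: d_sym)
    ultimately show False using no q by blast
  qed
qed

section \<open>Geodesics and closed walks\<close>

lemma geodesic_function:
  assumes "u \<in> V" "v \<in> V"
  obtains f where "f 0 = u" "f (d u v) = v" "\<And>i. i < d u v \<Longrightarrow> adj (f i) (f (Suc i))"
  using d_path[OF assms] unfolding relpow_fun_conv by blast

text \<open>A periodic sequence on all of \<open>nat\<close> lets indices be shifted freely; one
  period follows \<open>f\<close> forwards and then \<open>g\<close> backwards.\<close>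

lemma closed_walk:
  assumes f: "\<And>i. i < m \<Longrightarrow> adj (f i) (f (Suc i))"
    and g: "\<And>i. i < n \<Longrightarrow> adj (g i) (g (Suc i))"
    and fg: "f 0 = g 0" "f m = g n" and n: "n > 0"
  obtains c where "\<And>i. adj (c i) (c (Suc i))" "\<And>i. c (i + (m + n)) = c i"
    "\<And>i. i \<le> m \<Longrightarrow> c i = f i" "\<And>i. m \<le> i \<Longrightarrow> i \<le> m + n \<Longrightarrow> c i = g (m + n - i)"
proof -
  define c where "c i = (let r = i mod (m + n) in if r \<le> m then f r else g (m + n - r))" for i
  have c2: "c i = g (m + n - i)" if "m \<le> i" "i \<le> m + n" for i
    using that fg n by (cases "i = m + n") (auto simp: c_def Let_def)
  have c1: "c i = f i" if "i \<le> m" for i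
    using that n by (auto simp: c_def)
  have per: "c (i + (m + n)) = c i" for i by (simp add: c_def)
  have base: "adj (c r) (c (Suc r))" if r: "r < m + n" for r
  proof (cases "r < m")
    case True
    then show ?thesis using c1 f by simp
  next
    case False
    then have "c r = g (Suc (m + n - Suc r))" "c (Suc r) = g (m + n - Suc r)"
      using c2[of r] c2[of "Suc r"] r by (auto simp: Suc_diff_Suc)
    then show ?thesis using g[of "m + n - Suc r"] False r adj_sym by auto
  qed
  have per': "c (i mod (m + n)) = c i" for i by (simp add: c_def)
  have "adj (c i) (c (Suc i))" for i
  proof -
    have "c (Suc (i mod (m + n))) = c (Suc i)" by (simp add: c_def mod_Suc_eq)
    then show ?thesis using base[of "i mod (m + n)"] n per' by simp
  qed
  then show ?thesis using that per c1 c2 by blast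
qed

lemma walk_dist_le:
  assumes "\<And>i. adj (c i) (c (Suc i))"
  shows "d (c i) (c (i + r)) \<le> r"
  using d_le walk_relpow[of c E, OF assms] by blast

text \<open>By the triangle inequality a shortcut in the middle would shorten the whole
  stretch.\<close>

lemma walk_subgeodesic:
  assumes adj: "\<And>i. adj (c i) (c (Suc i))" and k: "d (c i) (c (i + (a + b + e))) = a + b + e"
  shows "d (c (i + a)) (c (i + (a + b))) = b"
proof -
  have V: "c i \<in> V" for i using adj adj_V by blast
  have "d (c i) (c (i + (a + b + e))) \<le> d (c i) (c (i + a)) + d (c (i + a)) (c (i + (a + b + e)))"
    "d (c (i + a)) (c (i + (a + b + e)))
      \<le> d (c (i + a)) (c (i + (a + b))) + d (c (i + (a + b))) (c (i + (a + b + e)))"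
    using d_triangle V by blast+
  then show ?thesis
    using walk_dist_le[of c i a, OF adj] walk_dist_le[of c "i + a" b, OF adj]
      walk_dist_le[of c "i + (a + b)" e, OF adj] k by (simp add: add.assoc)
qed

end

section \<open>The two conditions in bridged graphs\<close>

locale bridged = cgraph +
  assumes no_isometric_cycle: "\<not> (\<exists>W n. n > 3 \<and> cycle_graph n W (induced_edges E W) \<and> isometric_subgraph V E W)"
begin

lemma no_antipodal_cycle:
  assumes "\<And>i. adj (c i) (c (Suc i))" "\<And>i. c (i + L) = c i" "\<And>i. d (c i) (c (i + k)) = k"
    "L = 2 * k \<or> L = 2 * k + 1" "L > 3"
  shows False
  using isometric_cycle[OF assms] no_isometric_cycle assms(5) by blast

text \<open>In an induced pentagon nonconsecutive vertices are at distance 2, so the pentagon is an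
  isometric cycle.\<close>

lemma C5_free: C5_free
  unfolding C5_free_def
proof (intro allI impI, rule ccontr)
  fix a b c e f
  assume adj: "adj a b" "adj b c" "adj c e" "adj e f" "adj f a"
    and "\<not> (a = c \<or> b = e \<or> c = f \<or> e = a \<or> f = b \<or> adj a c \<or> adj b e \<or> adj c f \<or> adj e a \<or> adj f b)"
  then have dist: "d a c = 2" "d b e = 2" "d c f = 2" "d e a = 2" "d f b = 2"
    using d_two adj by blast+
  define h where "h i = [a, b, c, e, f] ! (i mod 5)" for i
  have m: "i mod 5 = 0 \<or> i mod 5 = 1 \<or> i mod 5 = 2 \<or> i mod 5 = 3 \<or> i mod 5 = 4" for i :: nat
    by presburger
  have "adj (h i) (h (Suc i))" for i
    using m[of i] adj by (auto simp: h_def mod_Suc)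
  moreover have "d (h i) (h (i + 2)) = 2" for i
    using m[of i] dist by (auto simp: h_def mod_Suc)
  moreover have "h (i + 5) = h i" for i by (simp add: h_def)
  ultimately show False using no_antipodal_cycle[of h 5 2] by simp
qed

text \<open>A counterexample at distance \<open>k\<close> yields a closed walk of length
  \<open>2k\<close> or \<open>2k + 1\<close>, and the antipodal lemmas carry it round the walk. All
  pairs \<open>k\<close> steps apart are then at distance \<open>k\<close>, so the walk is an
  isometric cycle of length at least 4.\<close>

lemma interval_triangle: "interval_cond k \<and> triangle_cond k"
proof (induction k rule: less_induct)
  case (less k)
  then have intj: "\<And>j. j < k \<Longrightarrow> interval_cond j" and trij: "\<And>j. j < k \<Longrightarrow> triangle_cond j" by auto
  have interval_cond: "interval_cond k"
    unfolding interval_cond_def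
  proof (intro ballI allI impI, rule ccontr)
    fix v x y z
    assume v: "v \<in> V" and adj: "adj z x" "adj z y" and dist: "d v z = k" "Suc (d v x) = k" "Suc (d v y) = k"
      and xy: "\<not> (x = y \<or> adj x y)"
    have V: "x \<in> V" "y \<in> V" "z \<in> V" using adj adj_V by blast+
    have k: "k \<ge> 2"
    proof (rule ccontr)
      assume "\<not> k \<ge> 2"
      then have "d v x = 0" "d v y = 0" using dist by auto
      then show False using xy V v by auto
    qed
    obtain f where f: "f 0 = v" "f (d v y) = y" "\<And>i. i < d v y \<Longrightarrow> adj (f i) (f (Suc i))"
      using geodesic_function[OF v V(2)] by blast
    obtain g where g: "g 0 = v" "g (d v x) = x" "\<And>i. i < d v x \<Longrightarrow> adj (g i) (g (Suc i))"
      using geodesic_function[OF v V(1)] by blast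
    \<comment> \<open>Both geodesics get a last step to \<open>z\<close>, so that the closed walk
      has length \<open>2k\<close> with \<open>v\<close> and \<open>z\<close> antipodal.\<close>
    define f' where "f' i = (if i = k then z else f i)" for i
    define g' where "g' i = (if i = k then z else g i)" for i
    have f': "adj (f' i) (f' (Suc i))" if "i < k" for i
    proof (cases "Suc i = k")
      case True
      then have "i = d v y" using dist by simp
      then show ?thesis using True f(2) adj(2)[THEN adj_sym] by (simp add: f'_def)
    next
      case False
      then show ?thesis using that f(3)[of i] dist by (simp add: f'_def)
    qed
    have g': "adj (g' i) (g' (Suc i))" if "i < k" for i
    proof (cases "Suc i = k")
      case True
      then have "i = d v x" using dist by simp
      then show ?thesis using True g(2) adj(1)[THEN adj_sym] by (simp add: g'_def)
    next
      case False
      then show ?thesis using that g(3)[of i] dist by (simp add: g'_def)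
    qed
    obtain c where c: "\<And>i. adj (c i) (c (Suc i))" "\<And>i. c (i + (k + k)) = c i"
      "\<And>i. i \<le> k \<Longrightarrow> c i = f' i" "\<And>i. k \<le> i \<Longrightarrow> i \<le> k + k \<Longrightarrow> c i = g' (k + k - i)"
    proof -
      have "f' 0 = g' 0" "f' k = g' k" "k > 0" using f(1) g(1) k by (auto simp: f'_def g'_def)
      then show thesis using closed_walk[of k f' k g'] f' g' that by blast
    qed
    obtain m where m: "k = m + 2" using that[of "k - 2"] k by simp
    \<comment> \<open>Since \<open>m = k - 2\<close>, the index \<open>i + m + 1\<close> is
      \<open>i + k - 1\<close>: the two walk neighbours of \<open>c (i + k)\<close> violate the
      interval condition with base \<open>c i\<close>.\<close>
    let ?Q = "\<lambda>i. d (c i) (c (i + k)) = k \<and> c (i + k + 1) \<noteq> c (i + m + 1) \<and> \<not> adj (c (i + k + 1)) (c (i + m + 1))"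
    have Q: "?Q i" for i
    proof (induction i)
      case 0
      have "c (k + 1) = x" using c(4)[of "k + 1"] g dist m by (simp add: g'_def)
      moreover have "c (m + 1) = y" using c(3)[of "m + 1"] f dist m by (simp add: f'_def)
      moreover have "c 0 = v" "c k = z" using c(3) f k by (auto simp: f'_def)
      ultimately show ?case using xy dist by auto
    next
      case (Suc i)
      have k1: "c (i + k + k) = c i" using c(2)[of i] by (simp add: add.assoc)
      have bk: "d (c (i + k)) (c (i + k + k)) = k" using Suc k1 by (simp add: d_sym)
      have a: "adj (c (i + k)) (c (i + k + 1))" "adj (c (i + m + 1)) (c (i + k))"
        "adj (c i) (c (i + 1))"
        using c(1)[of "i + k"] c(1)[of "i + m + 1"] c(1)[of i] m by auto
      have "Suc (d (c i) (c (i + k + 1))) = k"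
        using walk_subgeodesic[of c "i + k" 1 "m + 1" 0, OF c(1)] bk k1 m by (simp add: d_sym add.assoc)
      moreover have "Suc (d (c i) (c (i + m + 1))) = k"
        using walk_subgeodesic[of c i 0 "m + 1" 1, OF c(1)] Suc m by (simp add: add.assoc)
      moreover have "Suc (Suc (d (c (i + 1)) (c (i + m + 1)))) = k"
        using walk_subgeodesic[of c i 1 m 1, OF c(1)] Suc m by (simp add: add_ac)
      ultimately have "d (c (i + k + 1)) (c (i + 1)) = k"
        using interval_antipodal[OF intj trij C5_free k a(1) a(2)[THEN adj_sym] a(3)] Suc by blast
      \<comment> \<open>The next pair of walk neighbours lies on the geodesic from
        \<open>c (i + k)\<close> on to \<open>c i\<close>, so it is distinct and
        nonadjacent.\<close>
      moreover have "d (c (i + k)) (c (i + k + 2)) = 2"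
        using walk_subgeodesic[of c "i + k" 0 2 m, OF c(1)] bk m by (simp add: add_ac)
      then have "c (i + k + 2) \<noteq> c (i + k)" "\<not> adj (c (i + k + 2)) (c (i + k))"
        using d_adj adj_sym by fastforce+
      moreover have "i + m + 2 = i + k" using m by simp
      ultimately show ?case by (simp add: d_sym add_ac m)
    qed
    show False
      using no_antipodal_cycle[of c "k + k" k] c Q k by auto
  qed
  have "triangle_cond k"
    unfolding triangle_cond_def
  proof (intro ballI allI impI, rule ccontr)
    fix v x y
    assume v: "v \<in> V" and xy: "adj x y" and dist: "d v x = k" "d v y = k"
      and no: "\<not> (\<exists>z. adj x z \<and> adj y z \<and> Suc (d v z) = k)"
    have V: "x \<in> V" "y \<in> V" using xy adj_V by blast+
    have k: "k \<ge> 2"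
    proof (rule ccontr)
      assume "\<not> k \<ge> 2"
      then consider "k = 0" | "k = 1" by linarith
      then show False
      proof cases
        case 1
        then show False using dist V v xy adj_irrefl by auto
      next
        case 2
        then have "adj x v" "adj y v" using dist V v d_eq_1 adj_sym by blast+
        then show False using no 2 v by auto
      qed
    qed
    obtain f where f: "f 0 = v" "f k = y" "\<And>i. i < k \<Longrightarrow> adj (f i) (f (Suc i))"
      using geodesic_function[OF v V(2)] dist by metis
    obtain g where g: "g 0 = v" "g k = x" "\<And>i. i < k \<Longrightarrow> adj (g i) (g (Suc i))"
      using geodesic_function[OF v V(1)] dist by metis
    define g' where "g' i = (if i = Suc k then y else g i)" for i
    have g': "adj (g' i) (g' (Suc i))" if "i < Suc k" for i
      using that g xy by (cases "i = k") (auto simp: g'_def)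
    obtain c where c: "\<And>i. adj (c i) (c (Suc i))" "\<And>i. c (i + (k + Suc k)) = c i"
      "\<And>i. i \<le> k \<Longrightarrow> c i = f i" "\<And>i. k \<le> i \<Longrightarrow> i \<le> k + Suc k \<Longrightarrow> c i = g' (k + Suc k - i)"
    proof -
      have "f 0 = g' 0" "f k = g' (Suc k)" "Suc k > 0" using f g(1) k by (auto simp: g'_def)
      then show thesis using closed_walk[of k f "Suc k" g'] f(3) g' that by blast
    qed
    let ?Q = "\<lambda>i. d (c i) (c (i + k)) = k \<and> d (c i) (c (i + k + 1)) = k \<and>
      (\<forall>z. adj (c (i + k + 1)) z \<longrightarrow> adj (c (i + k)) z \<longrightarrow> Suc (d (c i) z) \<noteq> k)"
    obtain m where m: "k = m + 1" using that[of "k - 1"] k by simp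
    \<comment> \<open>The new base is \<open>c (i + k + 1)\<close> and the new opposite edge joins
      \<open>c i\<close> and \<open>c (i + 1)\<close>. Two such shifts by \<open>k + 1\<close>
      amount to a shift by 1 modulo the period \<open>2k + 1\<close>.\<close>
    have half: "?Q (i + (k + 1))" if Q: "?Q i" for i
    proof -
      have p: "c (i + (k + 1) + k) = c i" "c (i + (k + 1) + k + 1) = c (i + 1)"
        using c(2)[of i] c(2)[of "i + 1"] by (simp_all add: algebra_simps)
      have a: "adj (c (i + k + 1)) (c (i + k))" "adj (c i) (c (i + 1))"
        using c(1)[of "i + k"] c(1)[of i] adj_sym by auto
      have "Suc (d (c (i + 1)) (c (i + k))) = k"
        using walk_subgeodesic[of c i 1 m 0, OF c(1)] Q m by (simp add: add_ac)
      note t = triangle_antipodal[OF interval_cond trij k a _ _ this]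
      have t1: "d (c (i + k + 1)) (c (i + 1)) = k" using t(1) Q by blast
      have t2: "Suc (d (c (i + k + 1)) s) \<noteq> k" if "adj (c i) s" "adj (c (i + 1)) s" for s
        using t(2) Q that by blast
      show ?thesis
        unfolding p using t1 t2 Q by (auto simp: d_sym add.assoc)
    qed
    have Q: "?Q i" for i
    proof (induction i)
      case 0
      have "c (k + 1) = x" using c(4)[of "k + 1"] g by (simp add: g'_def)
      moreover have "c k = y" "c 0 = v" using c(3) f by auto
      ultimately show ?case using no dist by auto
    next
      case (Suc i)
      have e: "i + (k + 1) + (k + 1) = Suc i + (k + Suc k)" by simp
      have "c (i + (k + 1) + (k + 1)) = c (Suc i)"
        "c (i + (k + 1) + (k + 1) + k) = c (Suc i + k)"
        "c (i + (k + 1) + (k + 1) + k + 1) = c (Suc i + k + 1)"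
        using c(2)[of "Suc i"] c(2)[of "Suc i + k"] c(2)[of "Suc i + k + 1"]
        by (simp_all add: algebra_simps)
      then show ?case using half[OF half[OF Suc]] by simp
    qed
    show False
      using no_antipodal_cycle[of c "k + Suc k" k] c Q k by auto
  qed
  then show ?case using interval_cond by blast
qed

lemma interval_clique:
  assumes "v \<in> V" "adj z x" "adj z y" "Suc (d v x) = d v z" "Suc (d v y) = d v z"
  shows "x = y \<or> adj x y"
  using interval_condD[of "d v z" v z x y] interval_triangle assms by blast

lemma triangle:
  assumes "v \<in> V" "adj x y" "d v x = d v y"
  obtains z where "adj x z" "adj y z" "Suc (d v z) = d v x"
  using triangle_condD[of "d v x" v x y] interval_triangle assms by metis

text \<open>By induction on \<open>d x y\<close>. If \<open>z\<close> is outside, so is the first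
  step \<open>x1\<close> towards it. The next vertex \<open>x2\<close> towards \<open>y\<close> is
  also at distance \<open>R + 1\<close> from \<open>v\<close>, and a common neighbour
  \<open>c\<close> of \<open>x1\<close> and \<open>x2\<close> at distance \<open>R\<close> starts a
  shorter geodesic to \<open>y\<close> through \<open>x2\<close>, which by induction puts
  \<open>x2\<close> into the ball.\<close>

lemma ball_convex:
  assumes "v \<in> V" "x \<in> V" "y \<in> V" "z \<in> V" "d v x \<le> R" "d v y \<le> R" "d x z + d z y = d x y"
  shows "d v z \<le> R"
  using assms
proof (induction "d x y" arbitrary: R x y z rule: less_induct)
  case less
  note v = less.prems(1) and V = less.prems(2-4) and R = less.prems(5,6) and z = less.prems(7)
  show ?case
  proof (rule ccontr)
    assume zR: "\<not> d v z \<le> R"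
    then have "x \<noteq> z" using R by auto
    then obtain x1 where x1: "adj x x1" "Suc (d z x1) = d z x" using d_step[OF V(1) V(3)] by blast
    have x1V: "x1 \<in> V" using x1 adj_V by blast
    have x1y: "Suc (d x1 y) = d x y"
      using d_triangle[OF x1V V(3) V(2)] d_adj_le[OF x1(1) V(2)] x1(2) z by (simp add: d_sym)
    have x1z: "d x1 z + d z y = d x1 y" using x1(2) x1y z by (simp add: d_sym)
    have "\<not> d v x1 \<le> R"
      using less.hyps[OF _ v x1V V(2,3) _ R(2) x1z] x1y zR by auto
    then have vx1: "d v x1 = Suc R" "d v x = R" using d_adj_le[OF x1(1) v] R by auto
    have "x1 \<noteq> y" using R vx1 by auto
    then obtain x2 where x2: "adj x1 x2" "Suc (d y x2) = d y x1" using d_step[OF x1V V(2)] by blast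
    have x2V: "x2 \<in> V" using x2 adj_V by blast
    have xx2: "2 \<le> d x x2" using d_triangle[OF V(1) x2V V(2)] x1y x2(2) by (simp add: d_sym)
    have "d v x2 \<le> Suc R"
    proof (rule less.hyps[OF _ v x1V V(2) x2V])
      show "d x1 x2 + d x2 y = d x1 y" using x2 d_adj[OF x2(1)] by (simp add: d_sym)
    qed (use x1y vx1 R in auto)
    moreover have "d v x2 \<noteq> R"
      using interval_clique[OF v x1(1)[THEN adj_sym] x2(1)] vx1 xx2 d_adj by fastforce
    ultimately have vx2: "d v x2 = Suc R" using d_adj_le[OF x2(1) v] vx1 by auto
    obtain c where c: "adj x1 c" "adj x2 c" "Suc (d v c) = d v x1"
      using triangle[OF v x2(1)] vx1 vx2 by metis
    have cV: "c \<in> V" using c adj_V by blast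
    have "c \<noteq> x" using c(2) xx2 d_adj[of x2 x] by (auto simp: d_sym)
    then have cx: "adj x c" using interval_clique[OF v x1(1)[THEN adj_sym] c(1)] vx1 c(3) by auto
    have "d c y = d x1 y"
      using d_adj_le[OF cx V(2)] d_adj_le[OF c(2) V(2)] x1y x2(2) by (simp add: d_sym)
    have "d v x2 \<le> R"
    proof (intro less.hyps[OF _ v cV V(2) x2V])
      show "d c x2 + d x2 y = d c y" using x2(2) \<open>d c y = d x1 y\<close> d_adj[OF c(2)] by (simp add: d_sym)
    qed (use x1y vx1 R c(3) \<open>d c y = d x1 y\<close> in auto)
    then show False using vx2 by simp
  qed
qed

subsection \<open>Isometric sets\<close>

text \<open>A local form of isometry that, unlike \<open>isometric_subgraph\<close>, admits the empty set.\<close>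

definition isom :: "'a set \<Rightarrow> bool" where
  "isom W \<longleftrightarrow> W \<subseteq> V \<and> (\<forall>u\<in>W. \<forall>w\<in>W. u \<noteq> w \<longrightarrow> (\<exists>z\<in>W. adj u z \<and> Suc (d w z) = d w u))"

lemma isom_sub: "isom W \<Longrightarrow> W \<subseteq> V"
  by (simp add: isom_def)

lemma isom_step:
  assumes "isom W" "u \<in> W" "w \<in> W" "u \<noteq> w"
  obtains z where "z \<in> W" "adj u z" "Suc (d w z) = d w u"
  using assms unfolding isom_def by blast

lemma isom_path:
  assumes "isom W" "u \<in> W" "w \<in> W"
  shows "(u, w) \<in> induced_edges E W ^^ d w u"
  using assms(2)
proof (induction "d w u" arbitrary: u)
  case 0
  then show ?case using assms isom_sub d_eq_0[of w u] by auto
next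
  case (Suc n)
  then have "u \<noteq> w" by auto
  then obtain z where z: "z \<in> W" "adj u z" "Suc (d w z) = d w u"
    using isom_step[OF assms(1) Suc.prems assms(3)] by blast
  then have "(u, z) \<in> induced_edges E W" using Suc.prems by (auto simp: induced_edges_def)
  moreover have "n = d w z" using Suc.hyps(2) z(3) by linarith
  then have "(z, w) \<in> induced_edges E W ^^ n" using Suc.hyps(1) z(1) by metis
  ultimately show ?case using Suc.hyps(2) by (metis relpow_Suc_I2)
qed

text \<open>Distances agree with those of the whole graph, so an isometric cycle of the subgraph
  would be isometric in the whole graph. Results on bridged graphs can thus be applied inside
  \<open>W\<close>.\<close>

lemma isom_induced:
  assumes W: "isom W" "W \<noteq> {}"
  shows "bridged W (induced_edges E W)"
    and "\<And>u w. u \<in> W \<Longrightarrow> w \<in> W \<Longrightarrow> graph_dist (induced_edges E W) u w = d u w"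
proof -
  let ?F = "induced_edges E W"
  have F_sub: "?F ^^ n \<subseteq> E ^^ n" for n
    by (induction n) (auto simp: induced_edges_def)
  show dist: "graph_dist ?F u w = d u w" if "u \<in> W" "w \<in> W" for u w
    unfolding graph_dist_def[of ?F]
  proof (rule Least_equality)
    show "(u, w) \<in> ?F ^^ d u w" using isom_path[OF W(1) that] by (simp add: d_sym)
    show "d u w \<le> n" if "(u, w) \<in> ?F ^^ n" for n using that F_sub d_le by blast
  qed
  show "bridged W ?F"
  proof (unfold_locales, goal_cases)
    case 1
    show ?case
      unfolding connected_graph_def simple_graph_def
    proof (intro conjI ballI)
      show "W \<noteq> {}" by fact
      show "?F \<subseteq> W \<times> W" by (auto simp: induced_edges_def)
      show "sym ?F" using adj_sym by (auto simp: induced_edges_def sym_def)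
      show "irrefl ?F" using adj_irrefl by (auto simp: induced_edges_def irrefl_def)
      show "(u, v) \<in> ?F\<^sup>*" if "u \<in> W" "v \<in> W" for u v
        using isom_path[OF W(1) that] by (rule relpow_imp_rtrancl)
    qed
  next
    case 2
    show ?case
    proof
      assume "\<exists>C n. n > 3 \<and> cycle_graph n C (induced_edges ?F C) \<and> isometric_subgraph W ?F C"
      then obtain C n where C: "n > 3" "cycle_graph n C (induced_edges ?F C)" "isometric_subgraph W ?F C"
        by blast
      have CW: "C \<subseteq> W" using C by (simp add: isometric_subgraph_def)
      have e: "induced_edges ?F C = induced_edges E C" using CW by (auto simp: induced_edges_def)
      have "graph_dist (induced_edges E C) u v = d u v" if "u \<in> C" "v \<in> C" for u v
        using C(3) dist[of u v] that CW e unfolding isometric_subgraph_def by auto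
      then have "isometric_subgraph V E C"
        using C(3) CW isom_sub[OF W(1)] e unfolding isometric_subgraph_def by auto
      then show False using no_isometric_cycle C e by auto
    qed
  qed
qed

lemma isom_triangle:
  assumes W: "isom W" and V: "v \<in> W" "x \<in> W" "y \<in> W" and xy: "adj x y" "d v x = d v y"
  obtains z where "z \<in> W" "adj x z" "adj y z" "Suc (d v z) = d v x"
proof -
  have "W \<noteq> {}" using V by auto
  interpret W: bridged W "induced_edges E W" using isom_induced(1)[OF W \<open>W \<noteq> {}\<close>] .
  note dist = isom_induced(2)[OF W \<open>W \<noteq> {}\<close>]
  have "(x, y) \<in> induced_edges E W" using xy V by (auto simp: induced_edges_def)
  then obtain z where z: "(x, z) \<in> induced_edges E W" "(y, z) \<in> induced_edges E W"
    "Suc (graph_dist (induced_edges E W) v z) = graph_dist (induced_edges E W) v x"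
    using W.triangle[OF V(1)] dist V xy by metis
  then have "z \<in> W" using W.adj_V by blast
  then show ?thesis using that[of z] z dist V by (auto simp: induced_edges_def)
qed

section \<open>Neighbourhoods of isometric sets\<close>

definition nbhd :: "'a set \<Rightarrow> nat \<Rightarrow> 'a set \<Rightarrow> 'a set" where
  "nbhd U j A = {x\<in>U. \<exists>a\<in>A. d x a \<le> j}"

text \<open>For \<open>y\<close> outside \<open>A\<close>, a neighbour of \<open>y\<close> in
  \<open>A\<close> no farther from \<open>x\<close> than \<open>y\<close> provides the step,
  directly or by the triangle condition in \<open>U\<close>. If all are farther, a closest pair of
  \<open>a\<close> near \<open>x\<close> and \<open>b\<close> near \<open>y\<close> in
  \<open>A\<close> leads to \<open>key_configuration\<close>.\<close>

lemma isom_nbhd_1: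
  assumes U: "isom U" and A: "isom A" "A \<subseteq> U"
  shows "isom (nbhd U 1 A)"
  unfolding isom_def
proof (intro conjI ballI impI)
  let ?B = "nbhd U 1 A"
  have UV: "U \<subseteq> V" using U isom_sub by blast
  show "?B \<subseteq> V" using UV by (auto simp: nbhd_def)
  have AB: "A \<subseteq> ?B" using A by (force simp: nbhd_def)
  have BI: "z \<in> ?B" if "z \<in> U" "adj z b" "b \<in> A" for z b
    unfolding nbhd_def using that d_adj[OF that(2)] by (intro CollectI conjI bexI[of _ b]) auto
  fix y x assume y: "y \<in> ?B" and x: "x \<in> ?B" and "y \<noteq> x"
  have xU: "x \<in> U" "y \<in> U" using x y by (auto simp: nbhd_def)
  have V: "x \<in> V" "y \<in> V" using xU UV by auto
  define m where "m = d x y"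
  have m: "m \<ge> 1" using \<open>y \<noteq> x\<close> V d_eq_0[of x y] unfolding m_def by (cases "d x y") auto
  obtain b0 where b0: "b0 \<in> A" "d y b0 \<le> 1" using y by (auto simp: nbhd_def)
  have AV: "a \<in> V" if "a \<in> A" for a using that A UV by auto
  show "\<exists>z\<in>?B. adj y z \<and> Suc (d x z) = d x y"
  proof (cases "y \<in> A")
    case True
    obtain z where "z \<in> U" "adj y z" "Suc (d x z) = d x y"
      using isom_step[OF U xU(2) xU(1) \<open>y \<noteq> x\<close>] by blast
    then show ?thesis using BI[of z y] True adj_sym by blast
  next
    case yA: False
    define S where "S = {b\<in>A. adj y b}"
    have "b0 \<noteq> y" using b0 yA by auto
    then have "d y b0 \<noteq> 0" using AV b0 V by auto
    then have "d y b0 = 1" using b0 by simp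
    then have b0S: "b0 \<in> S" using b0 d_eq_1[OF V(2) AV[OF b0(1)]] by (auto simp: S_def)
    consider b where "b \<in> S" "Suc (d x b) = m" | b where "b \<in> S" "d x b = m" | "\<forall>b\<in>S. d x b = Suc m"
    proof -
      have "d x b = Suc m \<or> d x b = m \<or> Suc (d x b) = m" if "b \<in> S" for b
        using d_adj_le[of y b x] that V by (auto simp: S_def m_def)
      then show thesis using that by blast
    qed
    then show ?thesis
    proof cases
      case 1
      then show ?thesis using AB by (auto simp: S_def m_def)
    next
      case 2
      then have "b \<in> U" "adj y b" "b \<in> A" using A by (auto simp: S_def)
      then obtain z where z: "z \<in> U" "adj y z" "adj b z" "Suc (d x z) = d x y"
        using isom_triangle[OF U xU(1) xU(2), of b] 2(2) unfolding m_def by auto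
      then show ?thesis using BI[of z b] \<open>b \<in> A\<close> adj_sym by blast
    next
      case far: 3
      \<comment> \<open>The distance \<open>n\<close> between \<open>a\<close> and \<open>b\<close>
        is chosen least; consequently no vertex of \<open>A\<close> nearer to \<open>a\<close> than
        \<open>n\<close> is adjacent to \<open>y\<close>.\<close>
      have "\<exists>n a b. a \<in> A \<and> b \<in> S \<and> d a x \<le> 1 \<and> d a b = n"
        using x b0S by (auto simp: nbhd_def d_sym)
      then obtain n where n: "\<exists>a b. a \<in> A \<and> b \<in> S \<and> d a x \<le> 1 \<and> d a b = n"
        "\<And>n'. n' < n \<Longrightarrow> \<not> (\<exists>a b. a \<in> A \<and> b \<in> S \<and> d a x \<le> 1 \<and> d a b = n')"
        using exists_least_iff[of "\<lambda>n. \<exists>a b. a \<in> A \<and> b \<in> S \<and> d a x \<le> 1 \<and> d a b = n"] by blast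
      then obtain a b where a: "a \<in> A" "d a x \<le> 1" and bS: "b \<in> S" and ab: "d a b = n" by blast
      have least: "n \<le> d a' b'" if "a' \<in> A" "b' \<in> S" "d a' x \<le> 1" for a' b'
        using n(2) that not_less by blast
      have b: "b \<in> A" "adj y b" "d x b = Suc m" using bS far by (auto simp: S_def)
      have abV: "a \<in> V" "b \<in> V" using a b AV by auto
      have "Suc m \<le> 1 + n"
        using d_triangle[OF V(1) abV] a(2) b(3) ab by (simp add: d_sym)
      then have "a \<noteq> b" using ab m by auto
      have off: "c \<noteq> y \<and> \<not> adj c y" if "c \<in> A" "d a c < n" for c
      proof -
        have "c \<notin> S" using least[OF a(1) _ a(2), of c] that by auto
        then show ?thesis using that yA adj_sym by (auto simp: S_def)
      qed
      \<comment> \<open>The step \<open>c\<close> from \<open>b\<close> towards \<open>a\<close> is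
        far from \<open>x\<close>, whence \<open>n > m\<close>; the step \<open>a1\<close> from
        \<open>a\<close> towards \<open>b\<close> will rule out \<open>n = m + 2\<close>.\<close>
      obtain c where c: "c \<in> A" "adj b c" "Suc (d a c) = d a b"
        using isom_step[OF A(1) b(1) a(1) \<open>a \<noteq> b\<close>[symmetric]] by blast
      have "d a c < n" using c(3) ab by linarith
      then have cy: "c \<noteq> y" "\<not> adj c y" using off[OF c(1)] by blast+
      have "d x c \<noteq> m"
      proof
        assume "d x c = m"
        then have "c = y \<or> adj c y"
          using b(3) m_def by (intro interval_clique[OF V(1) c(2) b(2)[THEN adj_sym]]) simp_all
        then show False using cy by blast
      qed
      then have "Suc m \<le> d x c" using d_adj_le[OF c(2) V(1)] b(3) by auto
      then have nm: "Suc m \<le> n"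
        using d_triangle[OF V(1) abV(1) AV[OF c(1)]] a(2) c(3) ab by (simp add: d_sym)
      obtain a1 where a1: "a1 \<in> A" "adj a a1" "Suc (d b a1) = d b a"
        using isom_step[OF A(1) a(1) b(1) \<open>a \<noteq> b\<close>] by blast
      have a1x: "\<not> d a1 x \<le> 1" using least[OF a1(1) bS] a1(3) ab by (auto simp: d_sym)
      have "a \<noteq> x" using a1x d_adj[OF a1(2)] by (auto simp: d_sym)
      then have "adj a x" using a(2) d_eq_1[OF abV(1) V(1)] d_eq_0[OF abV(1) V(1)] by linarith
      have a1x': "x \<noteq> a1" "\<not> adj x a1" using a1x d_adj[of x a1] by (auto simp: d_sym)
      have "n \<noteq> Suc (Suc m)"
      proof
        assume "n = Suc (Suc m)"
        then have "x = a1 \<or> adj x a1"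
          using b(3) ab a1(3) d_sym[of b] by (intro interval_clique[OF abV(2) \<open>adj a x\<close> a1(2)]) presburger+
        then show False using a1x' by blast
      qed
      moreover have "n \<le> Suc (Suc m)"
        using d_adj_le[OF \<open>adj a x\<close> abV(2)] b(3) ab by (simp add: d_sym)
      ultimately have n': "n = Suc m" using nm by simp
      have "d a y \<noteq> m"
      proof
        assume "d a y = m"
        then have "c = y \<or> adj c y"
          using c(3) ab n' by (intro interval_clique[OF abV(1) c(2) b(2)[THEN adj_sym]]) simp_all
        then show False using cy by blast
      qed
      then have ay: "d a y = Suc m"
        using d_adj_le[OF \<open>adj a x\<close> V(2)] d_adj_le[OF b(2) abV(1)] ab n' by (auto simp: d_sym m_def)
      have "a1 \<noteq> b" using a1(3) ab n' m by (auto simp: d_sym)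
      then obtain c' where c': "c' \<in> A" "adj b c'" "Suc (d a1 c') = d a1 b"
        using isom_step[OF A(1) b(1) a1(1) \<open>a1 \<noteq> b\<close>[symmetric]] by blast
      have "d a c' < n"
        using d_adj_le[OF a1(2) AV[OF c'(1)]] c'(3) a1(3) ab by (simp add: d_sym)
      then have "y \<noteq> c'" "\<not> adj y c'" using off[OF c'(1)] adj_sym by auto
      moreover have "d a b = Suc m" "d a y = Suc m" "d x b = Suc m" "Suc (d a1 c') = m"
        using ab n' ay b(3) c'(3) a1(3) d_sym[of a1 b] d_sym[of a b] by linarith+
      ultimately have False
        using key_configuration[OF _ _ C5_free m \<open>adj a x\<close> b(2)[THEN adj_sym] a1(2) c'(2) m_def[symmetric]]
          interval_triangle a1x' by blast
      then show ?thesis by blast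
    qed
  qed
qed

lemma nbhd_0: "U \<subseteq> V \<Longrightarrow> A \<subseteq> U \<Longrightarrow> nbhd U 0 A = A"
  unfolding nbhd_def using d_eq_0 by (auto simp: subset_iff)

lemma nbhd_Suc:
  assumes "isom U" "A \<subseteq> U"
  shows "nbhd U (Suc j) A = nbhd U 1 (nbhd U j A)"
proof
  have UV: "U \<subseteq> V" using assms isom_sub by blast
  show "nbhd U (Suc j) A \<subseteq> nbhd U 1 (nbhd U j A)"
  proof
    fix x assume "x \<in> nbhd U (Suc j) A"
    then obtain a where x: "x \<in> U" "a \<in> A" "d x a \<le> Suc j" by (auto simp: nbhd_def)
    show "x \<in> nbhd U 1 (nbhd U j A)"
    proof (cases "x = a")
      case True
      then show ?thesis using x by (force simp: nbhd_def)
    next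
      case False
      then obtain z where z: "z \<in> U" "adj x z" "Suc (d a z) = d a x"
        using isom_step[OF assms(1) x(1)] x(2) assms(2) by blast
      then have "z \<in> nbhd U j A"
        unfolding nbhd_def using x by (intro CollectI conjI bexI[of _ a]) (auto simp: d_sym)
      then show ?thesis using x z d_adj[OF z(2)] by (force simp: nbhd_def)
    qed
  qed
  show "nbhd U 1 (nbhd U j A) \<subseteq> nbhd U (Suc j) A"
  proof
    fix x assume "x \<in> nbhd U 1 (nbhd U j A)"
    then obtain y a where "x \<in> U" "y \<in> U" "a \<in> A" "d x y \<le> 1" "d y a \<le> j" by (auto simp: nbhd_def)
    moreover have "d x a \<le> d x y + d y a" using calculation assms UV by (intro d_triangle) auto
    ultimately show "x \<in> nbhd U (Suc j) A" by (auto simp: nbhd_def intro!: bexI[of _ a])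
  qed
qed

lemma isom_nbhd:
  assumes "isom U" "isom A" "A \<subseteq> U"
  shows "isom (nbhd U j A)"
proof (induction j)
  case 0
  then show ?case using assms isom_sub nbhd_0 by metis
next
  case (Suc j)
  then show ?case
    using nbhd_Suc[OF assms(1,3)] isom_nbhd_1[OF assms(1) Suc] by (simp add: nbhd_def)
qed

end

text \<open>Complements turn intersections of chains into unions, to which the usual form of Zorn's
  lemma applies.\<close>

lemma subset_Zorn_minimal:
  assumes "S \<noteq> {}"
    and ch: "\<And>C. C \<noteq> {} \<Longrightarrow> C \<subseteq> S \<Longrightarrow> chain\<^sub>\<subseteq> C \<Longrightarrow> \<Inter>C \<in> S"
  shows "\<exists>M\<in>S. \<forall>X\<in>S. X \<subseteq> M \<longrightarrow> X = M"
proof -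
  have "\<exists>M\<in>uminus ` S. \<forall>X\<in>uminus ` S. M \<subseteq> X \<longrightarrow> X = M"
  proof (rule subset_Zorn_nonempty)
    show "uminus ` S \<noteq> {}" using assms(1) by blast
    fix C assume C: "C \<noteq> {}" "subset.chain (uminus ` S) C"
    have "\<Inter>(uminus ` C) \<in> S"
    proof (rule ch)
      show "uminus ` C \<noteq> {}" using C by blast
      show "uminus ` C \<subseteq> S" using C by (force simp: subset.chain_def)
      show "chain\<^sub>\<subseteq> (uminus ` C)"
        using C(2) unfolding chain_subset_def subset.chain_def by (auto simp: image_iff) blast
    qed
    moreover have "\<Union>C = - \<Inter>(uminus ` C)" by blast
    ultimately show "\<Union>C \<in> uminus ` S" by blast
  qed
  then show ?thesis by auto
qed

subsection \<open>Bridged graphs without infinite cliques\<close>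

locale clique_finite_bridged = bridged +
  assumes finite_clique: "\<And>K. K \<subseteq> V \<Longrightarrow> (\<And>x y. x \<in> K \<Longrightarrow> y \<in> K \<Longrightarrow> x = y \<or> adj x y) \<Longrightarrow> finite K"
begin

text \<open>Choosing \<open>x\<close> with the fewest possible first steps of geodesics from \<open>p\<close> (and inductively so
  from the next vertex) replaces the last vertex of a breadth first search, which need not exist
  in an infinite graph.\<close>

lemma domination:
  assumes W: "isom W" and p: "p \<in> W" and T: "T \<subseteq> W" "T \<noteq> {}" and n: "n \<ge> 1" "\<And>x. x \<in> T \<Longrightarrow> d p x = n"
  shows "\<exists>x\<in>T. \<exists>y\<in>W. adj x y \<and> Suc (d p y) = n \<and> (\<forall>u\<in>T. adj x u \<longrightarrow> adj y u)"
  using n p T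
proof (induction n arbitrary: p T)
  case 0
  then show ?case by simp
next
  case (Suc n)
  have WV: "W \<subseteq> V" using W isom_sub by blast
  then have pV: "p \<in> V" using Suc.prems by blast
  show ?case
  proof (cases "n = 0")
    case True
    have "adj p x" if "x \<in> T" for x
      using Suc.prems(2)[OF that] True d_eq_1[OF pV, of x] that Suc.prems(4) WV by auto
    moreover obtain x where "x \<in> T" using Suc.prems(5) by blast
    ultimately show ?thesis using Suc.prems(3) True adj_sym by (intro bexI[of _ x] bexI[of _ p]) auto
  next
    case False
    define C where "C x = {w\<in>W. adj p w \<and> d w x = n}" for x
    have Cfin: "finite (C x)" if "x \<in> T" for x
    proof (rule finite_clique)
      show "C x \<subseteq> V" using WV by (auto simp: C_def)
      have "x \<in> V" using that Suc.prems WV by blast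
      then show "u = v \<or> adj u v" if "u \<in> C x" "v \<in> C x" for u v
        using interval_clique[of x p u v] that Suc.prems(2)[OF \<open>x \<in> T\<close>] by (auto simp: C_def d_sym)
    qed
    obtain x0 where x0: "x0 \<in> T" "\<And>x. x \<in> T \<Longrightarrow> card (C x0) \<le> card (C x)"
      using ex_has_least_nat[of "\<lambda>x. x \<in> T" _ "\<lambda>x. card (C x)"] Suc.prems(5) by blast
    have "p \<noteq> x0" using Suc.prems(2)[OF x0(1)] by auto
    then obtain a where a: "a \<in> W" "adj p a" "Suc (d x0 a) = d x0 p"
      using isom_step[OF W Suc.prems(3), of x0] x0(1) Suc.prems(4) by blast
    then have aC: "a \<in> C x0" using Suc.prems(2)[OF x0(1)] by (auto simp: C_def d_sym)
    define T' where "T' = {x\<in>T. C x = C x0}"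
    have T': "d a x = n" if "x \<in> T'" for x using aC that by (auto simp: T'_def C_def)
    obtain x y where xy: "x \<in> T'" "y \<in> W" "adj x y" "Suc (d a y) = n"
      and dom: "\<And>u. u \<in> T' \<Longrightarrow> adj x u \<Longrightarrow> adj y u"
    proof -
      have "T' \<subseteq> W" "T' \<noteq> {}" using Suc.prems(4) x0(1) by (auto simp: T'_def)
      moreover have "n \<ge> 1" using False by simp
      ultimately have "\<exists>x\<in>T'. \<exists>y\<in>W. adj x y \<and> Suc (d a y) = n \<and> (\<forall>u\<in>T'. adj x u \<longrightarrow> adj y u)"
        using Suc.IH[of T' a] T' a(1) by blast
      then show thesis using that by blast
    qed
    have xT: "x \<in> T" "C x = C x0" using xy by (auto simp: T'_def)
    have V: "x \<in> V" "y \<in> V" using xy(3) adj_V by blast+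
    have py: "Suc (d p y) = Suc n"
      using d_adj_le[OF a(2) V(2)] d_adj_le[OF xy(3) pV] xy(4) Suc.prems(2)[OF xT(1)] by (auto simp: d_sym)
    have "adj y u" if u: "u \<in> T" "adj x u" for u
    proof (cases "u \<in> T'")
      case True
      then show ?thesis using dom u by blast
    next
      case False
      then have ne: "C u \<noteq> C x" using u xT by (auto simp: T'_def)
      \<comment> \<open>The cardinality of \<open>C x\<close> is least, so \<open>C u\<close>
        contains some \<open>b\<close> outside \<open>C x\<close>; the edge \<open>p b\<close> then
        satisfies the hypotheses of \<open>parent_adj\<close>.\<close>
      have "\<not> C u \<subseteq> C x"
        using ne card_seteq[OF Cfin[OF xT(1)], of "C u"] x0(2)[OF u(1)] xT(2) by auto
      then obtain b where b: "b \<in> C u" "b \<notin> C x" by blast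
      then have b': "b \<in> V" "adj p b" "d b u = n" "d b x \<noteq> n" using WV by (auto simp: C_def)
      have "d b x = Suc n"
        using d_adj_le[OF u(2) b'(1)] d_adj_le[OF b'(2) V(1)] b' Suc.prems(2)[OF xT(1)]
        by (auto simp: d_sym)
      then show ?thesis
        using parent_adj[of "Suc n" p b x u y] interval_triangle C5_free \<open>n \<noteq> 0\<close> b' u xy(3) py
          Suc.prems(2)[OF xT(1)] Suc.prems(2)[OF u(1)] by auto
    qed
    then show ?thesis using xT xy py by blast
  qed
qed

section \<open>Descending chains with empty intersection\<close>

definition empty_chain :: "'a set \<Rightarrow> 'a set set \<Rightarrow> bool" where
  "empty_chain U C \<longleftrightarrow> isom U \<and> U \<noteq> {} \<and> (\<forall>W\<in>C. isom W \<and> W \<noteq> {} \<and> W \<subseteq> U) \<and> chain\<^sub>\<subseteq> C \<and>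
     (\<forall>v\<in>U. \<exists>W\<in>C. v \<notin> W)"

lemma nbhd_mono: "A \<subseteq> B \<Longrightarrow> nbhd U j A \<subseteq> nbhd U j B"
  by (auto simp: nbhd_def)

text \<open>Nonadjacent vertices of the link are at distance 2. The vertex of \<open>A\<close>
  between them and \<open>v\<close> are both closer to one end, so the interval condition makes them
  adjacent; they differ as \<open>v\<close> is not in \<open>A\<close>.\<close>

lemma isom_link:
  assumes A: "isom A" "v \<in> V" "v \<notin> A"
  shows "isom {u\<in>A. adj v u}"
  unfolding isom_def
proof (intro conjI ballI impI)
  show "{u \<in> A. adj v u} \<subseteq> V" using isom_sub[OF A(1)] by auto
  fix u w assume u: "u \<in> {u \<in> A. adj v u}" and w: "w \<in> {u \<in> A. adj v u}" and "u \<noteq> w"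
  then have uw: "u \<in> A" "w \<in> A" "adj v u" "adj v w" by auto
  have wV: "w \<in> V" using uw adj_V by blast
  show "\<exists>z\<in>{u \<in> A. adj v u}. adj u z \<and> Suc (d w z) = d w u"
  proof (cases "adj u w")
    case True
    then have "d w u = 1" using d_adj adj_sym by blast
    then show ?thesis using True w by (intro bexI[of _ w]) auto
  next
    case False
    then have wu: "d w u = 2"
      using d_two[of w v u] uw adj_sym \<open>u \<noteq> w\<close> by blast
    obtain z where z: "z \<in> A" "adj u z" "Suc (d w z) = d w u"
      using isom_step[OF A(1) uw(1,2) \<open>u \<noteq> w\<close>] by blast
    have "z = v \<or> adj z v"
      by (rule interval_clique[OF wV z(2) uw(3)[THEN adj_sym] z(3)])
        (use d_adj[OF uw(4)[THEN adj_sym]] wu in simp)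
    then have "adj v z" using z(1) A(3) adj_sym by auto
    then show ?thesis using z by blast
  qed
qed

text \<open>Take the least \<open>k\<close> such that some \<open>v\<close> lies within
  \<open>k\<close> of every member, and let \<open>j = k - 1\<close>. The links of \<open>v\<close>
  in the \<open>j\<close>-neighbourhoods of the small members form the new chain; a vertex common to
  them would contradict the choice of \<open>k\<close>.\<close>

lemma empty_chain_step:
  assumes C: "empty_chain U C" and D: "\<And>x y. x \<in> U \<Longrightarrow> y \<in> U \<Longrightarrow> d x y \<le> D"
  shows "\<exists>v\<in>U. \<exists>U' C'. U' \<subseteq> U \<and> empty_chain U' C' \<and> (\<forall>u\<in>U'. adj v u)"
proof -
  have U: "isom U" "U \<noteq> {}" and W: "\<And>W. W \<in> C \<Longrightarrow> isom W \<and> W \<noteq> {} \<and> W \<subseteq> U"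
    and ch: "\<And>A B. A \<in> C \<Longrightarrow> B \<in> C \<Longrightarrow> A \<subseteq> B \<or> B \<subseteq> A" and em: "\<And>v. v \<in> U \<Longrightarrow> \<exists>W\<in>C. v \<notin> W"
    using C unfolding empty_chain_def chain_subset_def by blast+
  have UV: "U \<subseteq> V" using U isom_sub by blast
  let ?P = "\<lambda>k. \<exists>v\<in>U. \<forall>W\<in>C. v \<in> nbhd U k W"
  have PD: "?P D"
  proof -
    obtain v where v: "v \<in> U" using U by blast
    have "v \<in> nbhd U D A" if "A \<in> C" for A
      using W[OF that] D[OF v] v unfolding nbhd_def by blast
    then show ?thesis using v by blast
  qed
  define k where "k = (LEAST k. ?P k)"
  have Pk: "?P k" unfolding k_def using PD by (rule LeastI)
  have least: "\<not> ?P j" if "j < k" for j using not_less_Least[of j ?P] that unfolding k_def by blast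
  have "k \<noteq> 0"
  proof
    assume "k = 0"
    then obtain v where v: "v \<in> U" "\<And>W. W \<in> C \<Longrightarrow> v \<in> nbhd U 0 W" using Pk by blast
    have "v \<in> A" if "A \<in> C" for A using v(2)[OF that] nbhd_0[OF UV] W[OF that] by blast
    then show False using em v(1) by blast
  qed
  then obtain j where j: "k = Suc j" by (cases k) auto
  obtain v where v: "v \<in> U" "\<And>W. W \<in> C \<Longrightarrow> v \<in> nbhd U (Suc j) W" using Pk j by blast
  have vV: "v \<in> V" using v UV by blast
  \<comment> \<open>Passing to the members inside \<open>W0\<close> keeps \<open>v\<close> outside
    all \<open>j\<close>-neighbourhoods, as \<open>isom_link\<close> requires.\<close>
  obtain W0 where W0: "W0 \<in> C" "v \<notin> nbhd U j W0" using least[of j] j v(1) by auto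
  define L where "L W = {u \<in> nbhd U j W. adj v u}" for W
  have L_mono: "L A \<subseteq> L B" if "A \<subseteq> B" for A B using nbhd_mono[OF that] by (auto simp: L_def)
  define C' where "C' = L ` {W\<in>C. W \<subseteq> W0}"
  have vn: "v \<notin> nbhd U j A" if "A \<subseteq> W0" for A using nbhd_mono[OF that] W0 by blast
  have L: "isom (L A) \<and> L A \<noteq> {}" if A: "A \<in> C" "A \<subseteq> W0" for A
  proof
    show "isom (L A)" unfolding L_def
      by (intro isom_link isom_nbhd U vV vn) (use A W in auto)
    obtain a where a: "a \<in> A" "d v a \<le> Suc j" using v(2)[OF A(1)] by (auto simp: nbhd_def)
    have "v \<noteq> a" using vn[OF A(2)] a v(1) by (auto simp: nbhd_def)
    moreover have "a \<in> U" using a W[OF A(1)] by blast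
    ultimately obtain z where z: "z \<in> U" "adj v z" "Suc (d a z) = d a v"
      using isom_step[OF U(1) v(1)] by blast
    have "d z a \<le> j" using z(3) a(2) d_sym[of a] by simp
    then have "z \<in> L A" using z a(1) by (auto simp: L_def nbhd_def)
    then show "L A \<noteq> {}" by blast
  qed
  have "empty_chain (L W0) C'"
    unfolding empty_chain_def
  proof (intro conjI ballI)
    show "isom (L W0)" "L W0 \<noteq> {}" using L W0 by auto
    show "isom A" "A \<noteq> {}" if "A \<in> C'" for A using that L by (auto simp: C'_def)
    show "A \<subseteq> L W0" if "A \<in> C'" for A using that L_mono by (auto simp: C'_def)
    show "chain\<^sub>\<subseteq> C'"
      unfolding chain_subset_def C'_def
    proof clarify
      fix A B x y assume "A \<in> C" "B \<in> C" and x: "x \<in> L A" "x \<notin> L B" and y: "y \<in> L B"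
      then consider "A \<subseteq> B" | "B \<subseteq> A" using ch by blast
      then show "y \<in> L A" using L_mono x y by cases blast+
    qed
    show "\<exists>A\<in>C'. u \<notin> A" if u: "u \<in> L W0" for u
    proof (rule ccontr)
      assume "\<not> (\<exists>A\<in>C'. u \<notin> A)"
      then have *: "u \<in> nbhd U j A" if "A \<in> C" "A \<subseteq> W0" for A using that by (auto simp: C'_def L_def)
      have "u \<in> nbhd U j A" if "A \<in> C" for A
        using *[OF that] *[OF W0(1)] ch[OF that W0(1)] nbhd_mono[of W0 A U j] by blast
      moreover have "u \<in> U" using u by (auto simp: L_def nbhd_def)
      ultimately show False using least[of j] j by blast
    qed
  qed
  moreover have "L W0 \<subseteq> U" "\<forall>u\<in>L W0. adj v u" by (auto simp: L_def nbhd_def)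
  ultimately show ?thesis using v(1) by blast
qed

text \<open>Iterating the step lemma produces an infinite clique.\<close>

lemma no_empty_chain:
  assumes U: "empty_chain U C" and D: "\<And>x y. x \<in> U \<Longrightarrow> y \<in> U \<Longrightarrow> d x y \<le> D"
  shows False
proof -
  \<comment> \<open>A state is a vertex together with a set of its neighbours that still carries an
    empty chain; the next vertex is chosen in that set.\<close>
  let ?P = "\<lambda>x. fst x \<in> V \<and> snd x \<subseteq> U \<and> (\<exists>C. empty_chain (snd x) C) \<and> (\<forall>u\<in>snd x. adj (fst x) u)"
  let ?Q = "\<lambda>x y. fst y \<in> snd x \<and> snd y \<subseteq> snd x"
  have *: "\<exists>v'\<in>U'. \<exists>U''. U'' \<subseteq> U' \<and> ?P (v', U'')" if U': "U' \<subseteq> U" "empty_chain U' C'" for U' C'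
  proof -
    have "d x y \<le> D" if "x \<in> U'" "y \<in> U'" for x y using D U'(1) that by blast
    then obtain v U'' C'' where v: "v \<in> U'" "U'' \<subseteq> U'" "empty_chain U'' C''" "\<forall>u\<in>U''. adj v u"
      using empty_chain_step[OF U'(2)] by blast
    have "isom U'" using U'(2) by (simp add: empty_chain_def)
    then have "?P (v, U'')" using v U'(1) isom_sub[of U'] by auto
    then show ?thesis using v(1,2) by blast
  qed
  have "\<exists>f. \<forall>n. ?P (f n) \<and> ?Q (f n) (f (Suc n))"
  proof (rule dependent_nat_choice)
    show "\<exists>x. ?P x" using *[OF subset_refl U] by blast
    show "\<exists>y. ?P y \<and> ?Q x y" if x: "?P x" for x
    proof -
      obtain C' where C': "snd x \<subseteq> U" "empty_chain (snd x) C'" using x by blast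
      then obtain v' U'' where "v' \<in> snd x" "U'' \<subseteq> snd x" "?P (v', U'')" using *[OF C'] by blast
      then show ?thesis by (intro exI[of _ "(v', U'')"]) simp
    qed
  qed
  then obtain f where f: "\<And>n. ?P (f n) \<and> ?Q (f n) (f (Suc n))" by blast
  define v U' where "v n = fst (f n)" and "U' n = snd (f n)" for n
  have vU: "v n \<in> V" "\<And>u. u \<in> U' n \<Longrightarrow> adj (v n) u" "v (Suc n) \<in> U' n" "U' (Suc n) \<subseteq> U' n" for n
    using f[of n] by (auto simp: v_def U'_def)
  have "U' n \<subseteq> U' m" if "m \<le> n" for m n
    using vU(4) that by (rule lift_Suc_antimono_le[of U'])
  then have "v n \<in> U' m" if "m < n" for m n
    using that vU(3)[of "n - 1"] by (cases n) (auto simp: subset_iff less_Suc_eq_le)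
  then have adjv: "adj (v m) (v n)" if "m < n" for m n
    using that vU(2) by blast
  have "inj v"
    by (rule linorder_injI) (metis adjv adj_irrefl)
  moreover have "finite (range v)"
  proof (rule finite_clique)
    show "range v \<subseteq> V" using vU by blast
    show "x = y \<or> adj x y" if "x \<in> range v" "y \<in> range v" for x y
      using that adjv adj_sym by (metis (no_types) imageE linorder_neqE_nat)
  qed
  ultimately show False using finite_imageD infinite_UNIV_nat by blast
qed

text \<open>The possible steps from \<open>u\<close> towards \<open>w\<close> form a clique, so they
  are finitely many. If a member of the chain contains fewest of them, these lie in all
  members.\<close>

lemma isom_chain_Inter:
  assumes C: "C \<noteq> {}" "chain\<^sub>\<subseteq> C" and W: "\<And>W. W \<in> C \<Longrightarrow> isom W"
  shows "isom (\<Inter>C)"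
  unfolding isom_def
proof (intro conjI ballI impI)
  show "\<Inter>C \<subseteq> V" using C W isom_sub by blast
  fix u w assume uw: "u \<in> \<Inter>C" "w \<in> \<Inter>C" "u \<noteq> w"
  have V: "u \<in> V" "w \<in> V" using uw C W isom_sub by blast+
  define F where "F = {z\<in>V. adj u z \<and> Suc (d w z) = d w u}"
  have "finite F"
  proof (rule finite_clique)
    show "x = y \<or> adj x y" if "x \<in> F" "y \<in> F" for x y
      using interval_clique[OF V(2), of u x y] that by (auto simp: F_def)
  qed (auto simp: F_def)
  obtain A where A: "A \<in> C" "\<And>B. B \<in> C \<Longrightarrow> card (F \<inter> A) \<le> card (F \<inter> B)"
    using ex_has_least_nat[of "\<lambda>A. A \<in> C" _ "\<lambda>A. card (F \<inter> A)"] C(1) by blast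
  obtain z where z: "z \<in> A" "adj u z" "Suc (d w z) = d w u"
    using isom_step[OF W[OF A(1)]] uw A(1) by blast
  then have zF: "z \<in> F \<inter> A" using adj_V by (auto simp: F_def)
  have "z \<in> B" if B: "B \<in> C" for B
  proof (cases "A \<subseteq> B")
    case False
    then have "F \<inter> B \<subseteq> F \<inter> A" using C(2) A(1) B unfolding chain_subset_def by blast
    then have "F \<inter> B = F \<inter> A" using card_seteq[of "F \<inter> A" "F \<inter> B"] A(2)[OF B] \<open>finite F\<close> by simp
    then show ?thesis using zF by blast
  qed (use z in blast)
  then show "\<exists>z\<in>\<Inter>C. adj u z \<and> Suc (d w z) = d w u" using z by blast
qed

section \<open>Dominated vertices\<close>

definition closed_nbhd :: "'a set \<Rightarrow> 'a \<Rightarrow> 'a set" where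
  "closed_nbhd W z = {u\<in>W. u = z \<or> adj z u}"

text \<open>Strict inclusion makes no choice among vertices with equal closed neighbourhoods, so
  automorphisms preserve this set.\<close>

definition undominated :: "'a set \<Rightarrow> 'a set" where
  "undominated W = {z\<in>W. \<not> (\<exists>y\<in>W. closed_nbhd W z \<subset> closed_nbhd W y)}"

text \<open>The vertices dominating \<open>z\<close> form a clique, hence a finite set, and one with
  maximal closed neighbourhood among them is undominated.\<close>

lemma dominating_undominated:
  assumes W: "isom W" and z: "z \<in> W"
  obtains m where "m \<in> undominated W" "closed_nbhd W z \<subseteq> closed_nbhd W m"
proof -
  define D where "D = {m\<in>W. closed_nbhd W z \<subseteq> closed_nbhd W m}"
  have "finite D"
  proof (rule finite_clique)
    show "D \<subseteq> V" using isom_sub[OF W] by (auto simp: D_def)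
    show "x = y \<or> adj x y" if xy: "x \<in> D" "y \<in> D" for x y
    proof -
      have y: "y \<in> W" "closed_nbhd W z \<subseteq> closed_nbhd W y" and x: "closed_nbhd W z \<subseteq> closed_nbhd W x"
        using xy by (auto simp: D_def)
      have "z \<in> closed_nbhd W y" using y z by (auto simp: closed_nbhd_def)
      then have "y \<in> closed_nbhd W z" using y(1) adj_sym by (auto simp: closed_nbhd_def)
      then have "y \<in> closed_nbhd W x" using x by blast
      then show ?thesis by (auto simp: closed_nbhd_def)
    qed
  qed
  moreover have "z \<in> D" using z by (simp add: D_def)
  ultimately obtain m where m: "m \<in> D"
    "\<And>y. y \<in> D \<Longrightarrow> closed_nbhd W m \<subseteq> closed_nbhd W y \<Longrightarrow> closed_nbhd W m = closed_nbhd W y"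
    using finite_has_maximal[of "closed_nbhd W ` D"] by blast
  have "\<not> closed_nbhd W m \<subset> closed_nbhd W y" if "y \<in> W" for y
    using m(2)[of y] m(1) that by (auto simp: D_def)
  then have "m \<in> undominated W" using m(1) by (auto simp: undominated_def D_def)
  then show ?thesis using that m(1) by (auto simp: D_def)
qed

text \<open>On a geodesic from \<open>u\<close> to \<open>w\<close>, the vertex \<open>z\<close>
  after \<open>u\<close> may be replaced by an undominated \<open>m\<close> dominating it:
  \<open>m\<close> stays adjacent to \<open>u\<close> and to the vertex after
  \<open>z\<close>.\<close>

lemma isom_undominated:
  assumes W: "isom W"
  shows "isom (undominated W)"
  unfolding isom_def
proof (intro conjI ballI impI)
  show "undominated W \<subseteq> V" using isom_sub[OF W] by (auto simp: undominated_def)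
  fix u w assume uw: "u \<in> undominated W" "w \<in> undominated W" "u \<noteq> w"
  then have uW: "u \<in> W" "w \<in> W" by (auto simp: undominated_def)
  have wV: "w \<in> V" using uW isom_sub[OF W] by blast
  obtain z where z: "z \<in> W" "adj u z" "Suc (d w z) = d w u"
    using isom_step[OF W uW uw(3)] by blast
  show "\<exists>z\<in>undominated W. adj u z \<and> Suc (d w z) = d w u"
  proof (cases "z = w")
    case True
    then show ?thesis using z uw by blast
  next
    case False
    then obtain z' where z': "z' \<in> W" "adj z z'" "Suc (d w z') = d w z"
      using isom_step[OF W z(1) uW(2)] by blast
    obtain m where m: "m \<in> undominated W" "closed_nbhd W z \<subseteq> closed_nbhd W m"
      using dominating_undominated[OF W z(1)] by blast
    have "u \<in> closed_nbhd W m" "z' \<in> closed_nbhd W m"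
      using m(2) z z' uW adj_sym by (auto simp: closed_nbhd_def)
    then have mu: "m = u \<or> adj m u" and mz: "m = z' \<or> adj m z'"
      by (auto simp: closed_nbhd_def)
    have le: "d w m \<le> Suc (d w z')" using mz d_adj_le[OF _ wV] by auto
    then have "m \<noteq> u" using z(3) z'(3) by auto
    then have um: "adj u m" using mu adj_sym by blast
    then have "Suc (d w m) = d w u" using d_adj_le[OF um wV] le z(3) z'(3) by simp
    then show ?thesis using m(1) um by blast
  qed
qed

text \<open>A vertex \<open>x\<close> farthest from \<open>p\<close>, chosen by
  \<open>domination\<close>, is dominated by \<open>y\<close>: its neighbours at the same distance
  are covered by that choice, the closer ones by the interval condition. The inclusion is strict
  since \<open>y\<close> has a neighbour two steps closer to \<open>p\<close> than
  \<open>x\<close>.\<close>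

lemma exists_dominated:
  assumes W: "isom W" and D: "\<And>x y. x \<in> W \<Longrightarrow> y \<in> W \<Longrightarrow> d x y \<le> D"
    and pq: "p \<in> W" "q \<in> W" "p \<noteq> q" "\<not> adj p q"
  shows "undominated W \<noteq> W"
proof -
  have WV: "W \<subseteq> V" using isom_sub[OF W] .
  then have V: "p \<in> V" "q \<in> V" using pq by auto
  define n where "n = Max (d p ` W)"
  have fin: "finite (d p ` W)" using D[OF pq(1)] by (auto simp: finite_nat_set_iff_bounded_le)
  have le: "d p x \<le> n" if "x \<in> W" for x using fin that unfolding n_def by simp
  have "d p q \<noteq> 0" "d p q \<noteq> 1" using pq V d_eq_1[OF V] by auto
  then have n2: "n \<ge> 2" using le[OF pq(2)] by simp
  define T where "T = {x\<in>W. d p x = n}"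
  have "n \<in> d p ` W" using fin pq(1) unfolding n_def by (intro Max_in) auto
  then have "T \<noteq> {}" "T \<subseteq> W" by (auto simp: T_def)
  then obtain x y where xy: "x \<in> T" "y \<in> W" "adj x y" "Suc (d p y) = n"
    and dom: "\<And>u. u \<in> T \<Longrightarrow> adj x u \<Longrightarrow> adj y u"
  proof -
    have "\<exists>x\<in>T. \<exists>y\<in>W. adj x y \<and> Suc (d p y) = n \<and> (\<forall>u\<in>T. adj x u \<longrightarrow> adj y u)"
      using \<open>T \<noteq> {}\<close> \<open>T \<subseteq> W\<close> n2 by (intro domination[OF W pq(1)]) (auto simp: T_def)
    then show thesis using that by blast
  qed
  have x: "x \<in> W" "d p x = n" using xy by (auto simp: T_def)
  have "closed_nbhd W x \<subseteq> closed_nbhd W y"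
  proof
    fix u assume u: "u \<in> closed_nbhd W x"
    then have uW: "u \<in> W" by (simp add: closed_nbhd_def)
    show "u \<in> closed_nbhd W y"
    proof (cases "u = x \<or> u \<in> T")
      case True
      then show ?thesis using u dom[of u] adj_sym[OF xy(3)] by (auto simp: closed_nbhd_def)
    next
      case False
      then have xu: "adj x u" "d p u \<noteq> n" using u by (auto simp: closed_nbhd_def T_def)
      then have "Suc (d p u) = n" using d_adj_le[OF xu(1) V(1)] le[OF uW] x(2) by auto
      then have "y = u \<or> adj y u" using interval_clique[OF V(1) xy(3) xu(1)] xy(4) x(2) by auto
      then show ?thesis using uW by (auto simp: closed_nbhd_def)
    qed
  qed
  moreover have "closed_nbhd W x \<noteq> closed_nbhd W y"
  proof -
    have "y \<noteq> p" using xy(4) n2 by auto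
    then obtain z where z: "z \<in> W" "adj y z" "Suc (d p z) = d p y"
      using isom_step[OF W xy(2) pq(1)] by blast
    have "z \<noteq> x" "\<not> adj x z" using z(3) xy(4) x(2) d_adj_le[of x z p] V by auto
    then show ?thesis using z by (auto simp: closed_nbhd_def)
  qed
  ultimately have "x \<notin> undominated W" using xy(2) by (auto simp: undominated_def)
  then show ?thesis using x by blast
qed

section \<open>Finite groups of automorphisms\<close>

lemma invariant_clique:
  assumes F: "finite F" "F \<noteq> {}" and FV: "\<And>f x. f \<in> F \<Longrightarrow> x \<in> V \<Longrightarrow> f x \<in> V"
    and F_adj: "\<And>f x y. f \<in> F \<Longrightarrow> x \<in> V \<Longrightarrow> y \<in> V \<Longrightarrow> adj (f x) (f y) \<longleftrightarrow> adj x y"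
    and F_inv: "\<And>f. f \<in> F \<Longrightarrow> \<exists>h\<in>F. \<forall>x\<in>V. f (h x) = x \<and> h (f x) = x"
    and F_comp: "\<And>f g. f \<in> F \<Longrightarrow> g \<in> F \<Longrightarrow> \<exists>h\<in>F. \<forall>x\<in>V. f (g x) = h x"
  shows "\<exists>W. W \<subseteq> V \<and> W \<noteq> {} \<and> (\<forall>x\<in>W. \<forall>y\<in>W. x = y \<or> adj x y) \<and> (\<forall>f\<in>F. f ` W = W)"
proof -
  have F_le: "d (f x) (f y) \<le> d x y" if f: "f \<in> F" and xy: "x \<in> V" "y \<in> V" for f x y
  proof -
    have "(f x, f z) \<in> E ^^ n" if "(x, z) \<in> E ^^ n" for n z
      using that
    proof (induction n arbitrary: z)
      case (Suc n)
      then obtain t where t: "(x, t) \<in> E ^^ n" "adj t z" by auto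
      then have "adj (f t) (f z)" using F_adj[OF f] adj_V by blast
      then show ?case using Suc.IH[OF t(1)] by (meson relpow_Suc_I)
    qed auto
    then show ?thesis using d_path[OF xy] d_le by blast
  qed
  have F_d: "d (f x) (f y) = d x y" if f: "f \<in> F" and xy: "x \<in> V" "y \<in> V" for f x y
  proof -
    obtain h where h: "h \<in> F" "\<forall>x\<in>V. h (f x) = x" using F_inv[OF f] by blast
    then show ?thesis using F_le[OF f xy] F_le[OF h(1) FV[OF f xy(1)] FV[OF f xy(2)]] xy by force
  qed
  have F_img: "f ` W = W" if W: "W \<subseteq> V" "\<forall>f\<in>F. \<forall>x\<in>W. f x \<in> W" and f: "f \<in> F" for W f
  proof
    show "f ` W \<subseteq> W" using W f by blast
    obtain h where h: "h \<in> F" "\<forall>x\<in>V. f (h x) = x" using F_inv[OF f] by blast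
    show "W \<subseteq> f ` W"
    proof
      fix x assume x: "x \<in> W"
      then have "f (h x) = x" "h x \<in> W" using h W by auto
      then show "x \<in> f ` W" by (metis imageI)
    qed
  qed
  obtain v where v: "v \<in> V" using V_nonempty by blast
  \<comment> \<open>The largest distance between two orbit points: the orbit then lies in the
    intersection \<open>B\<close> of the balls of this radius around it.\<close>
  define R where "R = Max ((\<lambda>(g, h). d (g v) (h v)) ` (F \<times> F))"
  have R: "d (g v) (h v) \<le> R" if "g \<in> F" "h \<in> F" for g h
    unfolding R_def using that F(1) by (intro Max_ge) (auto intro!: rev_image_eqI[of "(g, h)"])
  define B where "B = {x\<in>V. \<forall>g\<in>F. d (g v) x \<le> R}"
  have BV: "B \<subseteq> V" by (auto simp: B_def)
  obtain f0 where f0: "f0 \<in> F" using F by blast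
  have B_ne: "f0 v \<in> B" using R f0 FV v by (auto simp: B_def)
  have B_isom: "isom B"
    unfolding isom_def
  proof (intro conjI ballI impI)
    fix u w assume uw: "u \<in> B" "w \<in> B" "u \<noteq> w"
    then have V: "u \<in> V" "w \<in> V" by (auto simp: B_def)
    obtain z where z: "adj u z" "Suc (d w z) = d w u" using d_step[OF V uw(3)] by blast
    have zV: "z \<in> V" using z adj_V by blast
    have "d u z + d z w = d u w" using d_adj[OF z(1)] z(2) d_sym[of w] by simp
    then have "d (g v) z \<le> R" if "g \<in> F" for g
      using ball_convex[OF FV[OF that v] V zV, of R] uw that by (auto simp: B_def)
    then show "\<exists>z\<in>B. adj u z \<and> Suc (d w z) = d w u" using z zV by (auto simp: B_def)
  qed (rule BV)
  have B_inv: "f x \<in> B" if f: "f \<in> F" and x: "x \<in> B" for f x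
  proof -
    have xV: "x \<in> V" using x BV by blast
    have "d (g v) (f x) \<le> R" if g: "g \<in> F" for g
    proof -
      \<comment> \<open>The orbit is permuted: with \<open>k\<close> acting as \<open>g\<close>
        followed by the inverse of \<open>f\<close>, the distance from \<open>g v\<close> to
        \<open>f x\<close> is that from \<open>k v\<close> to \<open>x\<close>.\<close>
      obtain h where h: "h \<in> F" "\<forall>x\<in>V. f (h x) = x \<and> h (f x) = x" using F_inv[OF f] by blast
      obtain k where k: "k \<in> F" "\<forall>x\<in>V. h (g x) = k x" using F_comp[OF h(1) g] by blast
      have "f (k v) = g v" using k h FV[OF g v] v by metis
      then have "d (g v) (f x) = d (k v) x" using F_d[OF f FV[OF k(1) v] xV] by simp
      then show ?thesis using x k(1) by (simp add: B_def)
    qed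
    then show ?thesis using FV[OF f xV] by (simp add: B_def)
  qed
  have bounded: "d x y \<le> R + R" if "x \<in> B" "y \<in> B" for x y
    using d_triangle[of x "f0 v" y] that FV[OF f0 v] f0 by (fastforce simp: B_def d_sym)
  define S where "S = {W. W \<noteq> {} \<and> W \<subseteq> B \<and> isom W \<and> (\<forall>f\<in>F. \<forall>x\<in>W. f x \<in> W)}"
  have "\<exists>M\<in>S. \<forall>X\<in>S. X \<subseteq> M \<longrightarrow> X = M"
  proof (rule subset_Zorn_minimal)
    have "B \<in> S" using B_ne B_isom B_inv by (auto simp: S_def)
    then show "S \<noteq> {}" by blast
    fix C assume C: "C \<noteq> {}" "C \<subseteq> S" "chain\<^sub>\<subseteq> C"
    have "\<Inter>C \<noteq> {}"
    proof
      assume "\<Inter>C = {}"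
      then have "empty_chain B C"
        unfolding empty_chain_def using C B_isom B_ne by (auto simp: S_def)
      then show False using no_empty_chain[of B C "R + R"] bounded by blast
    qed
    moreover have "isom (\<Inter>C)" using C by (intro isom_chain_Inter) (auto simp: S_def)
    moreover have "\<Inter>C \<subseteq> B" using C unfolding S_def by blast
    moreover have "\<forall>f\<in>F. \<forall>x\<in>\<Inter>C. f x \<in> \<Inter>C" using C(2) unfolding S_def by blast
    ultimately show "\<Inter>C \<in> S" by (simp add: S_def)
  qed
  then obtain W where W: "W \<in> S" and min: "\<And>X. X \<in> S \<Longrightarrow> X \<subseteq> W \<Longrightarrow> X = W" by blast
  have Wi: "isom W" "W \<noteq> {}" "W \<subseteq> B" and W_inv: "\<And>f x. f \<in> F \<Longrightarrow> x \<in> W \<Longrightarrow> f x \<in> W"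
    using W by (auto simp: S_def)
  have WV: "W \<subseteq> V" using Wi BV by blast
  have nbhd_img: "f u \<in> closed_nbhd W (f z) \<longleftrightarrow> u \<in> closed_nbhd W z"
    if f: "f \<in> F" and "u \<in> W" "z \<in> W" for f u z
  proof -
    have "f u = f z \<longleftrightarrow> u = z" using F_inv[OF f] that WV by (metis subsetD)
    then show ?thesis using F_adj[OF f, of z u] that WV W_inv by (auto simp: closed_nbhd_def)
  qed
  have "undominated W \<in> S"
    unfolding S_def
  proof (intro CollectI conjI ballI)
    obtain x where "x \<in> W" using Wi by blast
    then show "undominated W \<noteq> {}" using dominating_undominated[OF Wi(1)] by blast
    show "undominated W \<subseteq> B" using Wi by (auto simp: undominated_def)
    show "isom (undominated W)" using isom_undominated Wi by blast
    fix f z assume f: "f \<in> F" and z: "z \<in> undominated W"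
    then have zW: "z \<in> W" by (simp add: undominated_def)
    have img: "f ` W = W" using F_img[OF WV _ f] W_inv by simp
    show "f z \<in> undominated W"
    proof (rule ccontr)
      assume "f z \<notin> undominated W"
      then obtain y' where y': "y' \<in> W" "closed_nbhd W (f z) \<subset> closed_nbhd W y'"
        using W_inv[OF f zW] by (auto simp: undominated_def)
      then obtain y where y: "y \<in> W" "y' = f y" using img by blast
      have "closed_nbhd W z \<subseteq> closed_nbhd W y"
      proof
        fix u assume u: "u \<in> closed_nbhd W z"
        then have uW: "u \<in> W" by (simp add: closed_nbhd_def)
        then have "f u \<in> closed_nbhd W (f y)" using u nbhd_img[OF f uW zW] y' y by blast
        then show "u \<in> closed_nbhd W y" using nbhd_img[OF f uW y(1)] by blast
      qed
      moreover obtain t' where t': "t' \<in> closed_nbhd W (f y)" "t' \<notin> closed_nbhd W (f z)"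
        using y' y by blast
      then have "t' \<in> W" by (simp add: closed_nbhd_def)
      then obtain t where t: "t \<in> W" "t' = f t" using img by blast
      then have "t \<in> closed_nbhd W y" "t \<notin> closed_nbhd W z"
        using t' nbhd_img[OF f t(1)] y(1) zW by blast+
      ultimately show False using z y(1) by (auto simp: undominated_def)
    qed
  qed
  moreover have "undominated W \<subseteq> W" by (auto simp: undominated_def)
  ultimately have "undominated W = W" using min by blast
  then have "x = y \<or> adj x y" if "x \<in> W" "y \<in> W" for x y
    using exists_dominated[OF Wi(1), of "R + R" x y] bounded Wi(3) that by blast
  moreover have "\<forall>f\<in>F. f ` W = W" using F_img[OF WV] W_inv by simp
  ultimately show ?thesis using Wi(2) WV by (intro exI[of _ W]) simp
qed

end

subsection \<open>Systolic complexes\<close>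

theorem theorem7p3:
  fixes G :: "('g, 'm) monoid_scheme"
    and X :: "'a set set"
    and \<phi> :: "'g \<Rightarrow> 'a \<Rightarrow> 'a"
  assumes "finite (carrier G)"
    and "systolic_complex X"
    and "group_action G (vertices X) \<phi>"
    and "\<And>g. g \<in> carrier G \<Longrightarrow> simplicial_automorphism X (\<phi> g)"
  shows "\<exists>\<sigma>\<in>X. \<sigma> \<noteq> {} \<and> (\<forall>g\<in>carrier G. \<phi> g ` \<sigma> = \<sigma>)"
proof -
  interpret group_action G "vertices X" \<phi> by fact
  interpret G: group G using group_hom group_hom.axioms(1) by blast
  have flag: "flag_complex X" and br: "bridged_graph (vertices X) (skeleton_edges X)"
    using assms(2) by (auto simp: systolic_complex_def)
  have sc: "simplicial_complex X" using flag by (simp add: flag_complex_def)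
  have edge: "\<exists>\<sigma>\<in>X. u \<in> \<sigma> \<and> v \<in> \<sigma>" if "u \<in> vertices X" "u = v \<or> (u, v) \<in> skeleton_edges X" for u v
    using that by (auto simp: vertices_def skeleton_edges_def)
  \<comment> \<open>Flagness makes cliques of the 1-skeleton finite, and at the end it puts the
    invariant clique into a simplex.\<close>
  have clique: "\<exists>\<sigma>\<in>X. K \<subseteq> \<sigma>"
    if "K \<subseteq> vertices X" "\<And>x y. x \<in> K \<Longrightarrow> y \<in> K \<Longrightarrow> x = y \<or> (x, y) \<in> skeleton_edges X" for K
    using flag that edge unfolding flag_complex_def by (meson subsetD)
  interpret clique_finite_bridged "vertices X" "skeleton_edges X"
  proof unfold_locales
    show "connected_graph (vertices X) (skeleton_edges X)"
      and "\<not> (\<exists>W n. n > 3 \<and> cycle_graph n W (induced_edges (skeleton_edges X) W) \<and>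
        isometric_subgraph (vertices X) (skeleton_edges X) W)"
      using br unfolding bridged_graph_def by blast+
    show "finite K" if "K \<subseteq> vertices X"
      "\<And>x y. x \<in> K \<Longrightarrow> y \<in> K \<Longrightarrow> x = y \<or> (x, y) \<in> skeleton_edges X" for K
      using clique[OF that] sc unfolding simplicial_complex_def by (meson finite_subset)
  qed
  have \<phi>V: "\<phi> g x \<in> vertices X" if "g \<in> carrier G" "x \<in> vertices X" for g x
    using element_image[OF that] by blast
  have "\<exists>W. W \<subseteq> vertices X \<and> W \<noteq> {} \<and> (\<forall>x\<in>W. \<forall>y\<in>W. x = y \<or> (x, y) \<in> skeleton_edges X) \<and>
    (\<forall>f\<in>\<phi> ` carrier G. f ` W = W)"
  proof (rule invariant_clique)
    show "finite (\<phi> ` carrier G)" using assms(1) by simp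
    show "\<phi> ` carrier G \<noteq> {}" by auto
    fix f assume "f \<in> \<phi> ` carrier G"
    then obtain g where g: "g \<in> carrier G" "f = \<phi> g" by blast
    show "f x \<in> vertices X" if "x \<in> vertices X" for x using \<phi>V g that by blast
    show "(f x, f y) \<in> skeleton_edges X \<longleftrightarrow> (x, y) \<in> skeleton_edges X"
      if xy: "x \<in> vertices X" "y \<in> vertices X" for x y
    proof -
      have "f x = f y \<longleftrightarrow> x = y" using inj_prop[OF g(1)] xy g(2) by (auto simp: inj_on_def)
      moreover have "\<sigma> \<subseteq> vertices X \<Longrightarrow> f ` \<sigma> \<in> X \<longleftrightarrow> \<sigma> \<in> X" for \<sigma>
        using assms(4)[OF g(1)] g(2) unfolding simplicial_automorphism_def by simp
      from this[of "{x, y}"] have "{f x, f y} \<in> X \<longleftrightarrow> {x, y} \<in> X" using xy by simp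
      ultimately show ?thesis by (simp add: skeleton_edges_def)
    qed
    show "\<exists>h\<in>\<phi> ` carrier G. \<forall>x\<in>vertices X. f (h x) = x \<and> h (f x) = x"
    proof (intro bexI ballI conjI)
      fix x assume x: "x \<in> vertices X"
      \<comment> \<open>Here \<open>orbit_sym_aux\<close> is applied to the inverse of
        \<open>g\<close>, so that inverting once more gives back \<open>g\<close>.\<close>
      show "f (\<phi> (inv\<^bsub>G\<^esub> g) x) = x"
        using orbit_sym_aux[of "inv\<^bsub>G\<^esub> g" x "\<phi> (inv\<^bsub>G\<^esub> g) x"] g x by simp
      show "\<phi> (inv\<^bsub>G\<^esub> g) (f x) = x" using orbit_sym_aux[OF g(1) x] g by simp
    qed (use g in simp)
    fix f' assume "f' \<in> \<phi> ` carrier G"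
    then obtain g' where g': "g' \<in> carrier G" "f' = \<phi> g'" by blast
    show "\<exists>h\<in>\<phi> ` carrier G. \<forall>x\<in>vertices X. f (f' x) = h x"
      using composition_rule g g' by (intro bexI[of _ "\<phi> (g \<otimes>\<^bsub>G\<^esub> g')"]) auto
  qed
  then obtain W where W: "W \<subseteq> vertices X" "W \<noteq> {}" "\<forall>x\<in>W. \<forall>y\<in>W. x = y \<or> (x, y) \<in> skeleton_edges X"
    "\<forall>g\<in>carrier G. \<phi> g ` W = W" by auto
  then obtain \<sigma> where "\<sigma> \<in> X" "W \<subseteq> \<sigma>" using clique by meson
  then have "W \<in> X" using sc W(2) unfolding simplicial_complex_def by blast
  then show ?thesis using W by blast
qed

end
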